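(* Let $I_\bullet$ be a boric chain. Then there exist finitely many boron trees $T_1,\ldots,T_r$ and polynomials $f_i\in R_{T_i}$ ($1\le i\le r$) such that for any boron tree $T$ the ideal $I_T$ of $R_T$ is generated by the elements $\phi_*(f_i)$ as $i$ varies in $\{1,\ldots,r\}$ and $\phi$ varies over all embeddings $T_i\to T$.
   Context: A boron tree is a finite (non-empty) tree in which every internal vertex has valence three (the trees with one or two vertices are allowed). The internal vertices are called boron atoms and the leaves hydrogen atoms (the vertex of a one-vertex tree is counted as a hydrogen atom). $T_H$ denotes the set of hydrogen atoms of $T$. It carries a quaternary relation $\rho$: $\rho(w,x;y,z)$ holds if the geodesic (path in the tree, including endpoints) joining $w$ and $x$ intersects the geodesic joining $y$ and $z$. An embedding $\phi\colon T\to T'$ of boron trees is an embedding of structures $(T_H,\rho)\to(T'_H,\rho)$, i.e. an injective map $T_H\to T'_H$ such that $\rho(w,x;y,z)$ holds if and only if $\rho(\phi(w),\phi(x);\phi(y),\phi(z))$ holds. For a boron tree $T$, let $R_T=\mathbf{C}[x_i]_{i\in T_H}$. An embedding $\phi\colon T\to T'$ induces the $\mathbf{C}$-algebra homomorphism $\phi_*\colon R_T\to R_{T'}$ with $\phi_*(x_i)=x_{\phi(i)}$. A boric chain is a rule $I_\bullet$ assigning to each boron tree $T$ an ideal $I_T$ of $R_T$ such that $\phi_*(I_T)\subset I_{T'}$ for every embedding $\phi\colon T\to T'$. *)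

theory Defs
  imports
    Complex_Main
    "HOL-Library.Poly_Mapping"
    "HOL-Algebra.Ideal"
    "Graph_Theory.Graph_Theory"
begin

text \<open>
  Undirected simple graphs are symmetric loopfree digraphs without parallel arcs
  (\<^locale>\<open>pair_graph\<close>, which includes finiteness).  The library's notion of a tree forbids every
  directed cycle, in particular the closed walk u, v, u along an edge of a symmetric digraph, so
  it is not the notion needed here.  A closed walk of length at least three that does not
  repeat vertices is a cycle of the undirected graph.
\<close>

definition undirected_tree :: "'v pair_pre_digraph \<Rightarrow> bool" where
  "undirected_tree T \<longleftrightarrow>
     pair_graph T \<and>
     Digraph_Component.connected (with_proj T) \<and>
     (\<nexists>p. pre_digraph.cycle (with_proj T) p \<and> 3 \<le> length p)"

text \<open>
  Every edge is represented by two opposite arcs, so the out-degree of a vertex is its valence.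
  The bound \<open>\<le> 1\<close> instead of \<open>= 1\<close> makes the vertex of a one-vertex tree a hydrogen atom.
\<close>

definition hydrogen :: "'v pair_pre_digraph \<Rightarrow> 'v set" where
  "hydrogen T = {v \<in> pverts T. out_degree (with_proj T) v \<le> 1}"

definition boron_tree :: "'v pair_pre_digraph \<Rightarrow> bool" where
  "boron_tree T \<longleftrightarrow>
     undirected_tree T \<and> (\<forall>v \<in> pverts T - hydrogen T. out_degree (with_proj T) v = 3)"

text \<open>The vertices of the path from \<open>x\<close> to \<open>y\<close>, which in a tree exists and is unique.\<close>

definition geodesic :: "'v pair_pre_digraph \<Rightarrow> 'v \<Rightarrow> 'v \<Rightarrow> 'v set" where
  "geodesic T x y = \<Union> {set (pawalk_verts x p) | p. pre_digraph.apath (with_proj T) x p y}"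

definition rho :: "'v pair_pre_digraph \<Rightarrow> 'v \<Rightarrow> 'v \<Rightarrow> 'v \<Rightarrow> 'v \<Rightarrow> bool" where
  "rho T w x y z \<longleftrightarrow> geodesic T w x \<inter> geodesic T y z \<noteq> {}"

text \<open>Only the values of \<open>\<phi>\<close> on the hydrogen atoms of \<open>T\<close> are relevant.\<close>

definition boron_embedding ::
    "('v \<Rightarrow> 'v) \<Rightarrow> 'v pair_pre_digraph \<Rightarrow> 'v pair_pre_digraph \<Rightarrow> bool" where
  "boron_embedding \<phi> T T' \<longleftrightarrow>
     \<phi> ` hydrogen T \<subseteq> hydrogen T' \<and> inj_on \<phi> (hydrogen T) \<and>
     (\<forall>w \<in> hydrogen T. \<forall>x \<in> hydrogen T. \<forall>y \<in> hydrogen T. \<forall>z \<in> hydrogen T.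
        rho T w x y z \<longleftrightarrow> rho T' (\<phi> w) (\<phi> x) (\<phi> y) (\<phi> z))"

text \<open>
  A polynomial maps each monomial (a finitely supported exponent function) to its coefficient.
\<close>

type_synonym 'v cpoly = "('v \<Rightarrow>\<^sub>0 nat) \<Rightarrow>\<^sub>0 complex"

definition cconst :: "complex \<Rightarrow> 'v cpoly" where
  "cconst c = Poly_Mapping.single 0 c"

definition cvar :: "'v \<Rightarrow> 'v cpoly" where
  "cvar i = Poly_Mapping.single (Poly_Mapping.single i 1) 1"

definition poly_ring_over :: "'v set \<Rightarrow> 'v cpoly ring" where
  "poly_ring_over V =
     \<lparr>carrier = {f. \<forall>m \<in> Poly_Mapping.keys f. Poly_Mapping.keys m \<subseteq> V},
      monoid.mult = (*), one = 1, zero = 0, add = (+)\<rparr>"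

definition boron_ring :: "'v pair_pre_digraph \<Rightarrow> 'v cpoly ring" where
  "boron_ring T = poly_ring_over (hydrogen T)"

definition pushforward :: "('v \<Rightarrow> 'v) \<Rightarrow> 'v cpoly \<Rightarrow> 'v cpoly" where
  "pushforward \<phi> f =
     (\<Sum>m \<in> Poly_Mapping.keys f.
        cconst (Poly_Mapping.lookup f m) *
        (\<Prod>i \<in> Poly_Mapping.keys m. cvar (\<phi> i) ^ Poly_Mapping.lookup m i))"

text \<open>
  The trees range over those with vertices in an arbitrary fixed type \<open>'v\<close>; if it is infinite,
  every boron tree is isomorphic to one of them.  The values of \<open>I\<close> outside boron trees are
  irrelevant.
\<close>

definition boric_chain :: "('v pair_pre_digraph \<Rightarrow> 'v cpoly set) \<Rightarrow> bool" where
  "boric_chain I \<longleftrightarrow>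
     (\<forall>T. boron_tree T \<longrightarrow> ideal (I T) (boron_ring T)) \<and>
     (\<forall>T T' \<phi>. boron_tree T \<longrightarrow> boron_tree T' \<longrightarrow> boron_embedding \<phi> T T' \<longrightarrow>
        pushforward \<phi> ` I T \<subseteq> I T')"

lemma cring_poly_ring_over: "cring (poly_ring_over V)"
proof -
  have add: "f + g \<in> carrier (poly_ring_over V)"
    if "f \<in> carrier (poly_ring_over V)" "g \<in> carrier (poly_ring_over V)" for f g :: "'a cpoly"
    using that Poly_Mapping.keys_add[of f g] unfolding poly_ring_over_def by auto
  have mult: "f * g \<in> carrier (poly_ring_over V)"
    if fg: "f \<in> carrier (poly_ring_over V)" "g \<in> carrier (poly_ring_over V)" for f g :: "'a cpoly"
  proof -
    have "Poly_Mapping.keys m \<subseteq> V" if m: "m \<in> Poly_Mapping.keys (f * g)" for m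
    proof -
      obtain a b where "m = a + b" "a \<in> Poly_Mapping.keys f" "b \<in> Poly_Mapping.keys g"
        using m Poly_Mapping.keys_mult[of f g] by blast
      then show ?thesis
        using fg Poly_Mapping.keys_add[of a b] unfolding poly_ring_over_def by fastforce
    qed
    then show ?thesis by (simp add: poly_ring_over_def)
  qed
  have neg: "- f \<in> carrier (poly_ring_over V)"
    if "f \<in> carrier (poly_ring_over V)" for f :: "'a cpoly"
    using that by (simp add: poly_ring_over_def)
  note ops = poly_ring_over_def
  have [simp]: "f \<oplus>\<^bsub>poly_ring_over V\<^esub> g = f + g" "f \<otimes>\<^bsub>poly_ring_over V\<^esub> g = f * g"
    "\<zero>\<^bsub>poly_ring_over V\<^esub> = 0" "\<one>\<^bsub>poly_ring_over V\<^esub> = 1" for f g :: "'a cpoly"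
    by (simp_all add: ops)
  have [simp]: "0 \<in> carrier (poly_ring_over V)" "1 \<in> carrier (poly_ring_over V)"
    by (simp_all add: ops)
  show ?thesis
  proof (rule cringI)
    show "abelian_group (poly_ring_over V)"
    proof (rule abelian_groupI)
      fix f assume "f \<in> carrier (poly_ring_over V)"
      then show "\<exists>g\<in>carrier (poly_ring_over V). g \<oplus>\<^bsub>poly_ring_over V\<^esub> f = \<zero>\<^bsub>poly_ring_over V\<^esub>"
        by (intro bexI[of _ "- f"]) (simp_all add: neg)
    qed (simp_all add: add ac_simps)
    show "comm_monoid (poly_ring_over V)"
      by (rule comm_monoidI) (simp_all add: mult ac_simps)
  qed (simp add: distrib_right)
qed

end

theory Submission
  imports Defs "HOL-Library.Ramsey" "HOL-Library.Sublist"
begin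

text \<open>
  The proof is a Groebner basis argument in which Kruskal's tree theorem takes the place of
  Dickson's lemma.

  Subdividing an edge of a boron tree \<open>T\<close> and rooting it there turns it into a binary tree whose
  leaves are the hydrogen atoms; choosing a left and a right child at each vertex moreover orders
  the leaves.  (A tree with one vertex becomes a single leaf.)  A monomial of \<open>R\<^sub>T\<close>
  labels every leaf with an exponent.  By Kruskal's theorem
  (\<open>kruskal_btree\<close>) the binary trees with leaves labelled by natural numbers are well-quasi-ordered
  under embeddings that respect left and right and do not decrease labels.

  Such an embedding has two properties.  First, it is an embedding of boron trees
  (\<open>tree_code_embedding\<close>): \<open>\<rho>(w,x;y,z)\<close> fails exactly if removing some edge separates \<open>w\<close>, \<open>x\<close>
  from \<open>y\<close>, \<open>z\<close>, the parts cut off by edges are the leaf sets of subtrees up to complement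
  (\<open>boron_tree_has_code\<close>), and the leaf sets of subtrees of the source are the nonempty preimages
  of those of the target.  Secondly, it preserves the order of the leaves, hence also the
  lexicographic order of monomials (\<open>monomial_less_relabel\<close>), so that \<open>\<phi>\<^sub>*\<close> maps leading
  monomials to leading monomials.

  Now consider the leading monomials of the nonzero elements of all the ideals \<open>I\<^sub>T\<close>.  The labelled
  trees that they define have a finite subset such that each of them lies above a member of it
  (\<open>finite_basis\<close>); the elements \<open>f\<^sub>i\<close> are polynomials that realize these finitely many leading
  monomials.  The leading monomial of any nonzero \<open>f\<close> in \<open>I\<^sub>T\<close> is then a multiple of the leading
  monomial of some \<open>\<phi>\<^sub>*(f\<^sub>i)\<close>, and subtracting a multiple of \<open>\<phi>\<^sub>*(f\<^sub>i)\<close> decreases the leading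
  monomial of \<open>f\<close> (\<open>reduction_step\<close>).  As the lexicographic order of the monomials in finitely many
  variables is well-founded, finitely many steps lead to \<open>0\<close>.
\<close>

section \<open>Kruskal's theorem for leaf-labelled binary trees\<close>

datatype 'a btree = Leaf 'a | Node "'a btree" "'a btree"

text \<open>
  A leaf may be mapped to a leaf anywhere below, and an inner vertex to an inner vertex anywhere
  below, such that left and right subtrees are mapped into left and right subtrees.  The source
  and the target may carry labels of different types, so that one relation serves both for trees of
  exponents and for trees of hydrogen atoms.
\<close>

fun embeds :: "('a \<Rightarrow> 'b \<Rightarrow> bool) \<Rightarrow> 'a btree \<Rightarrow> 'b btree \<Rightarrow> bool" where
  "embeds P (Leaf a) (Leaf b) \<longleftrightarrow> P a b"
| "embeds P (Leaf a) (Node t1 t2) \<longleftrightarrow> embeds P (Leaf a) t1 \<or> embeds P (Leaf a) t2"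
| "embeds P (Node s1 s2) (Leaf b) \<longleftrightarrow> False"
| "embeds P (Node s1 s2) (Node t1 t2) \<longleftrightarrow>
     embeds P (Node s1 s2) t1 \<or> embeds P (Node s1 s2) t2 \<or> embeds P s1 t1 \<and> embeds P s2 t2"

lemma embeds_Node: "embeds P s t1 \<or> embeds P s t2 \<Longrightarrow> embeds P s (Node t1 t2)"
  by (cases s) auto

text \<open>
  Ramsey's theorem for the colouring of the pairs \<open>i < j\<close> by \<open>P (f i) (f j)\<close>: the assumption excludes
  a homogeneous set of the other colour.  Well-quasi-orders of pairs are reduced to those of the
  components in this way.
\<close>

lemma homogeneous_subsequence:
  fixes f :: "nat \<Rightarrow> 'a"
  assumes good: "\<And>h::nat \<Rightarrow> nat. strict_mono h \<Longrightarrow> \<exists>i j. i < j \<and> P (f (h i)) (f (h j))"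
  shows "\<exists>h::nat \<Rightarrow> nat. strict_mono h \<and> (\<forall>i j. i < j \<longrightarrow> P (f (h i)) (f (h j)))"
proof -
  define c where "c = (\<lambda>X :: nat set. if P (f (Min X)) (f (Max X)) then 0 else 1 :: nat)"
  have "\<forall>x\<in>UNIV. \<forall>y\<in>UNIV. x \<noteq> y \<longrightarrow> c {x, y} < 2" by (simp add: c_def)
  then have "\<exists>Y t. Y \<subseteq> UNIV \<and> infinite Y \<and> t < 2 \<and> (\<forall>x\<in>Y. \<forall>y\<in>Y. x \<noteq> y \<longrightarrow> c {x, y} = t)"
    by (intro Ramsey2 infinite_UNIV_nat)
  then obtain Y t where Y: "infinite Y" "\<forall>x\<in>Y. \<forall>y\<in>Y. x \<noteq> y \<longrightarrow> c {x, y} = t"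
    by (elim exE conjE)
  have mono: "strict_mono (enumerate Y)"
    using Y(1) by (rule strict_mono_enumerate)
  have color: "P (f (enumerate Y i)) (f (enumerate Y j)) \<longleftrightarrow> t = 0" if "i < j" for i j
  proof -
    let ?x = "enumerate Y i" and ?y = "enumerate Y j"
    have less: "?x < ?y" using mono that by (rule strict_monoD)
    have "c {?x, ?y} = t"
      by (rule Y(2)[rule_format]) (use less Y(1) in \<open>simp_all add: enumerate_in_set less_imp_neq\<close>)
    moreover have "Min {?x, ?y} = ?x" "Max {?x, ?y} = ?y" using less by simp_all
    ultimately show ?thesis unfolding c_def by (metis zero_neq_one)
  qed
  have "t = 0" using good[OF mono] color by blast
  show ?thesis
    by (rule exI[of _ "enumerate Y"]) (simp add: mono color \<open>t = 0\<close>)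
qed

text \<open>
  The minimal bad sequence of Nash-Williams: the entries are chosen one after the other, each of
  minimal size among the bad sequences that continue the entries chosen before.
\<close>

lemma minimal_bad_sequence:
  fixes P :: "'a \<Rightarrow> 'a \<Rightarrow> bool" and b :: "nat \<Rightarrow> 'a" and size :: "'a \<Rightarrow> nat"
  assumes "\<forall>i j. i < j \<longrightarrow> \<not> P (b i) (b j)"
  shows "\<exists>f :: nat \<Rightarrow> 'a. (\<forall>i j. i < j \<longrightarrow> \<not> P (f i) (f j)) \<and>
    (\<forall>n g. (\<forall>i<n. g i = f i) \<longrightarrow> (\<forall>i j. i < j \<longrightarrow> \<not> P (g i) (g j)) \<longrightarrow> size (f n) \<le> size (g n))"
proof -
  define bad where "bad g \<longleftrightarrow> (\<forall>i j. i < j \<longrightarrow> \<not> P (g i) (g j))" for g :: "nat \<Rightarrow> 'a"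
  define Q where "Q n h h' \<longleftrightarrow> (\<forall>i<n. h' i = h i) \<and>
      (\<forall>g. bad g \<and> (\<forall>i<n. g i = h i) \<longrightarrow> size (h' n) \<le> size (g n))" for n and h h' :: "nat \<Rightarrow> 'a"
  have "\<exists>H. \<forall>n. bad (H n) \<and> Q n (H n) (H (Suc n))"
  proof (rule dependent_nat_choice)
    show "\<exists>h. bad h" using assms unfolding bad_def by (intro exI[of _ b])
    show "\<exists>h'. bad h' \<and> Q n h h'" if h: "bad h" for h n
    proof -
      let ?S = "\<lambda>g. bad g \<and> (\<forall>i<n. g i = h i)"
      have "?S (arg_min (\<lambda>g. size (g n)) ?S) \<and>
          (\<forall>g. ?S g \<longrightarrow> size (arg_min (\<lambda>g. size (g n)) ?S n) \<le> size (g n))"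
        by (rule arg_min_nat_lemma) (use h in auto)
      then show ?thesis unfolding Q_def by blast
    qed
  qed
  then obtain H where bad: "bad (H n)" and Q: "Q n (H n) (H (Suc n))" for n by blast
  have agree: "H (Suc n) i = H n i" if "i < n" for n i
    using Q[of n] that unfolding Q_def by blast
  have least: "size (H (Suc n) n) \<le> size (g n)" if "bad g" "\<forall>i<n. g i = H n i" for n g
    using Q[of n] that unfolding Q_def by blast
  \<comment> \<open>\<open>H n\<close> is final in the places below \<open>n\<close>, so the sequences \<open>H n\<close> have a limit.\<close>
  define f where "f n = H (Suc n) n" for n
  have stable: "H m i = f i" if "i < m" for i m
    using that
  proof (induction m)
    case (Suc m)
    show ?case
    proof (cases "i = m")
      case False
      with Suc show ?thesis by (simp add: agree)
    qed (simp add: f_def)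
  qed simp
  show ?thesis
  proof (intro exI[of _ f] conjI allI impI)
    show "\<not> P (f i) (f j)" if "i < j" for i j
    proof -
      have "\<not> P (H (Suc j) i) (H (Suc j) j)" using bad that by (simp add: bad_def)
      then show ?thesis using that by (simp add: stable)
    qed
    show "size (f n) \<le> size (g n)" if "\<forall>i<n. g i = f i" "\<forall>i j. i < j \<longrightarrow> \<not> P (g i) (g j)" for n g
      unfolding f_def by (rule least) (use that stable in \<open>simp_all add: bad_def\<close>)
  qed
qed

fun children :: "'a btree \<Rightarrow> 'a btree set" where
  "children (Leaf a) = {}"
| "children (Node s t) = {s, t}"

text \<open>
  In a minimal bad sequence \<open>f\<close> the children of the entries contain no bad sequence.  Hence if
  infinitely many entries are inner vertices, then two of these have comparable left children and
  comparable right children, and thus are comparable themselves; otherwise infinitely many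
  entries are leaves, and their labels are comparable.
\<close>

theorem kruskal_btree:
  fixes P :: "'a \<Rightarrow> 'a \<Rightarrow> bool" and b :: "nat \<Rightarrow> 'a btree"
  assumes wqo: "\<And>a :: nat \<Rightarrow> 'a. \<exists>i j. i < j \<and> P (a i) (a j)"
  shows "\<exists>i j. i < j \<and> embeds P (b i) (b j)"
proof (rule ccontr)
  assume "\<not> ?thesis"
  then have "\<forall>i j. i < j \<longrightarrow> \<not> embeds P (b i) (b j)" by simp
  from minimal_bad_sequence[where P = "embeds P" and size = size, OF this]
  show False
  proof (elim exE conjE)
    fix f :: "nat \<Rightarrow> 'a btree"
    assume bad: "\<forall>i j. i < j \<longrightarrow> \<not> embeds P (f i) (f j)"
      and minimal: "\<forall>n g. (\<forall>i<n. g i = f i) \<longrightarrow> (\<forall>i j. i < j \<longrightarrow> \<not> embeds P (g i) (g j)) \<longrightarrow>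
        size (f n) \<le> size (g n)"
    have children: "\<exists>i j. i < j \<and> embeds P (c i) (c j)"
      if k: "strict_mono k" "\<And>n. c n \<in> children (f (k n))" for c and k :: "nat \<Rightarrow> nat"
    proof (rule ccontr)
      assume "\<not> ?thesis"
      then have c_bad: "\<not> embeds P (c i) (c j)" if "i < j" for i j using that by simp
      \<comment> \<open>The bad sequence \<open>c\<close> of children may replace the part of \<open>f\<close> from the first parent on.
        The result is bad because what embeds into a child embeds into its parent, and it
        contradicts minimality at the place of that parent.\<close>
      define g where "g n = (if n < k 0 then f n else c (n - k 0))" for n
      have up: "embeds P s (f (k n))" if "embeds P s (c n)" for s n
        using k(2)[of n] that by (cases "f (k n)") (auto intro: embeds_Node)
      have "\<not> embeds P (g i) (g j)" if "i < j" for i j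
      proof (cases "k 0 \<le> j \<and> i < k 0")
        case True
        have "k 0 \<le> k (j - k 0)" using k(1) by (simp add: strict_mono_less_eq)
        with True have "i < k (j - k 0)" by linarith
        with bad have "\<not> embeds P (f i) (f (k (j - k 0)))" by blast
        then show ?thesis using up[of "f i" "j - k 0"] True by (auto simp: g_def)
      next
        case False
        then consider "j < k 0" | "k 0 \<le> i" by linarith
        then show ?thesis
        proof cases
          case 1
          then show ?thesis using bad that by (simp add: g_def)
        next
          case 2
          then show ?thesis using c_bad[of "i - k 0" "j - k 0"] that by (simp add: g_def)
        qed
      qed
      then have "size (f (k 0)) \<le> size (g (k 0))" by (intro minimal[rule_format]) (auto simp: g_def)
      moreover have "size (c 0) < size (f (k 0))" using k(2)[of 0] by (cases "f (k 0)") auto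
      ultimately show False by (simp add: g_def)
    qed
    define L where "L = {n. \<exists>a. f n = Leaf a}"
    show False
    proof (cases "finite L")
      case False
      define a where "a n = (THE a. f (enumerate L n) = Leaf a)" for n
      have a: "f (enumerate L n) = Leaf (a n)" for n
        using enumerate_in_set[OF False, of n] by (auto simp: L_def a_def)
      obtain i j where "i < j" "P (a i) (a j)" using wqo by blast
      then have "embeds P (f (enumerate L i)) (f (enumerate L j))" "enumerate L i < enumerate L j"
        using a False by (auto simp: enumerate_mono)
      with bad show False by blast
    next
      case True
      then have inf: "infinite (- L)" by simp
      let ?k = "enumerate (- L)"
      define l where "l n = (THE s. \<exists>t. f (?k n) = Node s t)" for n
      define r where "r n = (THE t. \<exists>s. f (?k n) = Node s t)" for n
      have node: "f (?k n) = Node (l n) (r n)" for n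
        using enumerate_in_set[OF inf, of n] by (cases "f (?k n)") (auto simp: L_def l_def r_def)
      have k: "strict_mono ?k" using inf by (rule strict_mono_enumerate)
      have "\<exists>h::nat \<Rightarrow> nat. strict_mono h \<and> (\<forall>i j. i < j \<longrightarrow> embeds P (l (h i)) (l (h j)))"
      proof (rule homogeneous_subsequence)
        fix h :: "nat \<Rightarrow> nat" assume "strict_mono h"
        then show "\<exists>i j. i < j \<and> embeds P (l (h i)) (l (h j))"
          using k node by (intro children[of "?k \<circ> h" "\<lambda>n. l (h n)"]) (auto simp: strict_mono_def)
      qed
      then obtain h :: "nat \<Rightarrow> nat" where h: "strict_mono h"
        "\<forall>i j. i < j \<longrightarrow> embeds P (l (h i)) (l (h j))" by (elim exE conjE)
      have "\<exists>i j. i < j \<and> embeds P (r (h i)) (r (h j))"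
        using k node h(1) by (intro children[of "?k \<circ> h" "\<lambda>n. r (h n)"]) (auto simp: strict_mono_def)
      then obtain i j where "i < j" "embeds P (r (h i)) (r (h j))" by blast
      then have "embeds P (f (?k (h i))) (f (?k (h j)))" "?k (h i) < ?k (h j)"
        using node h k by (auto simp: strict_mono_def)
      with bad show False by blast
    qed
  qed
qed

lemma embeds_map: "embeds P (map_btree f s) (map_btree g t) \<longleftrightarrow> embeds (\<lambda>x y. P (f x) (g y)) s t"
  by (induction "\<lambda>x y. P (f x) (g y)" s t rule: embeds.induct) auto

lemma nat_sequence_not_decreasing: "\<exists>i j. i < j \<and> a i \<le> (a j :: nat)" for a :: "nat \<Rightarrow> nat"
proof -
  obtain i where "\<And>j. a i \<le> a j" using ex_has_least_nat[of "\<lambda>_. True" 0 a] by auto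
  then show ?thesis by (intro exI[of _ i] exI[of _ "Suc i"]) simp
qed

text \<open>
  Otherwise one could choose elements of \<open>A\<close> one after the other, each of them above none of the
  elements chosen before.
\<close>

lemma finite_basis:
  assumes wqo: "\<And>a :: nat \<Rightarrow> 'a. \<exists>i j. i < j \<and> P (a i) (a j)"
  shows "\<exists>B. finite B \<and> B \<subseteq> A \<and> (\<forall>a\<in>A. \<exists>b\<in>B. P b a)"
proof (rule ccontr)
  assume no_basis: "\<not> ?thesis"
  define new where "new B = (SOME a. a \<in> A \<and> (\<forall>b\<in>B. \<not> P b a))" for B
  have new: "new B \<in> A \<and> (\<forall>b\<in>B. \<not> P b (new B))" if "finite B" "B \<subseteq> A" for B
  proof -
    have "\<not> (\<forall>a\<in>A. \<exists>b\<in>B. P b a)" using no_basis that by simp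
    then have "\<exists>a. a \<in> A \<and> (\<forall>b\<in>B. \<not> P b a)" by blast
    then show ?thesis unfolding new_def by (rule someI_ex)
  qed
  define B where "B = rec_nat {} (\<lambda>_ B. insert (new B) B)"
  have B_Suc: "B (Suc n) = insert (new (B n)) (B n)" for n by (simp add: B_def)
  have B: "finite (B n) \<and> B n \<subseteq> A" for n
  proof (induction n)
    case 0
    then show ?case by (simp add: B_def)
  next
    case (Suc n)
    then show ?case using new[of "B n"] by (simp add: B_Suc)
  qed
  have "new (B i) \<in> B j" if "i < j" for i j
    using that by (induction j) (auto simp: B_Suc less_Suc_eq)
  then have "\<not> P (new (B i)) (new (B j))" if "i < j" for i j
    using new[of "B j"] B[of j] that by simp
  moreover obtain i j where "i < j" "P (new (B i)) (new (B j))"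
    using wqo[of "\<lambda>n. new (B n)"] by auto
  ultimately show False by simp
qed

section \<open>Embeddings as maps of leaves\<close>

fun leaves :: "'a btree \<Rightarrow> 'a list" where
  "leaves (Leaf a) = [a]"
| "leaves (Node s t) = leaves s @ leaves t"

text \<open>
  Cutting an edge of a rooted tree splits the set of leaves into a cluster and its complement.  The
  clusters therefore determine the underlying unrooted tree.
\<close>

fun clusters :: "'a btree \<Rightarrow> 'a set set" where
  "clusters (Leaf a) = {{a}}"
| "clusters (Node s t) = insert (set (leaves s) \<union> set (leaves t)) (clusters s \<union> clusters t)"

definition separated :: "'a set set \<Rightarrow> 'a set \<Rightarrow> 'a set \<Rightarrow> bool" where
  "separated \<C> A B \<longleftrightarrow> (\<exists>C\<in>\<C>. A \<subseteq> C \<and> B \<inter> C = {} \<or> B \<subseteq> C \<and> A \<inter> C = {})"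

lemma clusters_top: "set (leaves t) \<in> clusters t"
  by (cases t) auto

lemma clusters_subset: "C \<in> clusters t \<Longrightarrow> C \<subseteq> set (leaves t)"
  by (induction t) auto

definition traces :: "'a btree \<Rightarrow> ('a \<Rightarrow> 'b) \<Rightarrow> 'b btree \<Rightarrow> 'a set set" where
  "traces s \<phi> t = (\<lambda>C. set (leaves s) \<inter> \<phi> -` C) ` clusters t"

text \<open>
  A map of leaves that comes from an embedding of binary trees.  The traces are the preimages of the
  clusters of the target.  The empty set is inserted on both sides because a cluster that does not
  meet the image has an empty trace.
\<close>

definition realizes :: "('a \<Rightarrow> 'b \<Rightarrow> bool) \<Rightarrow> ('a \<Rightarrow> 'b) \<Rightarrow> 'a btree \<Rightarrow> 'b btree \<Rightarrow> bool" where
  "realizes P \<phi> s t \<longleftrightarrow> subseq (map \<phi> (leaves s)) (leaves t) \<and>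
     (\<forall>x \<in> set (leaves s). P x (\<phi> x)) \<and> insert {} (traces s \<phi> t) = insert {} (clusters s)"

lemma subseq_set_subset: "subseq xs ys \<Longrightarrow> set xs \<subseteq> set ys"
  by (induction rule: list_emb.induct) auto

lemma subseq_distinct: "subseq xs ys \<Longrightarrow> distinct ys \<Longrightarrow> distinct xs"
  by (induction rule: list_emb.induct) (auto dest: subseq_set_subset)

lemma realizes_image: "realizes P \<phi> s t \<Longrightarrow> \<phi> ` set (leaves s) \<subseteq> set (leaves t)"
  by (metis realizes_def subseq_set_subset image_set)

text \<open>
  Passing from \<open>t1\<close> or \<open>t2\<close> to \<open>Node t1 t2\<close> adds only trivial traces: the clusters of the other
  subtree miss the image of \<open>\<phi>\<close>, and the new top cluster contains it.
\<close>

lemma realizes_descend: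
  assumes \<phi>: "realizes P \<phi> s t" and t: "t = t1 \<or> t = t2"
    and distinct: "distinct (leaves (Node t1 t2))"
  shows "realizes P \<phi> s (Node t1 t2)"
proof -
  have image: "\<phi> ` set (leaves s) \<subseteq> set (leaves t)" using \<phi> by (rule realizes_image)
  have off: "set (leaves s) \<inter> \<phi> -` C = {}" if "C \<subseteq> set (leaves t')" "set (leaves t) \<inter> set (leaves t') = {}" for C t'
    using image that by blast
  have top: "set (leaves s) \<inter> \<phi> -` (set (leaves t1) \<union> set (leaves t2)) = set (leaves s)"
    using image t by blast
  have *: "traces s \<phi> (Node t1 t2) = insert (set (leaves s)) (traces s \<phi> t1 \<union> traces s \<phi> t2)"
    unfolding traces_def clusters.simps image_insert image_Un top ..
  have "insert {} (traces s \<phi> (Node t1 t2)) = insert {} (insert (set (leaves s)) (traces s \<phi> t))"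
    using t
  proof
    assume "t = t1"
    then have "C \<in> clusters t2 \<Longrightarrow> set (leaves s) \<inter> \<phi> -` C = {}" for C
      using off[of C t2] clusters_subset[of C t2] distinct by simp
    then have "traces s \<phi> t2 \<subseteq> {{}}" by (auto simp only: traces_def)
    then show ?thesis unfolding * using \<open>t = t1\<close> by blast
  next
    assume "t = t2"
    then have "C \<in> clusters t1 \<Longrightarrow> set (leaves s) \<inter> \<phi> -` C = {}" for C
      using off[of C t1] clusters_subset[of C t1] distinct by (simp add: Int_commute)
    then have "traces s \<phi> t1 \<subseteq> {{}}" by (auto simp only: traces_def)
    then show ?thesis unfolding * using \<open>t = t2\<close> by blast
  qed
  also have "\<dots> = insert {} (clusters s)"
    using \<phi> clusters_top[of s] unfolding realizes_def by blast
  finally have "insert {} (traces s \<phi> (Node t1 t2)) = insert {} (clusters s)" .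
  moreover have "subseq (map \<phi> (leaves s)) (leaves t1 @ leaves t2)"
    using \<phi> t unfolding realizes_def by (auto intro: subseq_drop_many subseq_rev_drop_many)
  ultimately show ?thesis using \<phi> by (simp add: realizes_def)
qed

lemma traces_cong:
  assumes "\<And>x. x \<in> set (leaves s) \<Longrightarrow> \<phi> x = \<psi> x"
  shows "traces s \<phi> t = traces s \<psi> t"
  unfolding traces_def using assms by (intro image_cong) auto

lemma realizes_cong:
  assumes "\<And>x. x \<in> set (leaves s) \<Longrightarrow> \<phi> x = \<psi> x"
  shows "realizes P \<phi> s t \<longleftrightarrow> realizes P \<psi> s t"
proof -
  have 1: "map \<phi> (leaves s) = map \<psi> (leaves s)" using assms by simp
  have 2: "(\<forall>x \<in> set (leaves s). P x (\<phi> x)) \<longleftrightarrow> (\<forall>x \<in> set (leaves s). P x (\<psi> x))"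
    using assms by simp
  have 3: "traces s \<phi> t = traces s \<psi> t" using assms by (rule traces_cong)
  show ?thesis unfolding realizes_def 1 2 3 ..
qed

lemma realizes_Node:
  assumes \<phi>: "realizes P \<phi> s1 t1" "realizes P \<phi> s2 t2"
    and distinct: "distinct (leaves (Node t1 t2))"
  shows "realizes P \<phi> (Node s1 s2) (Node t1 t2)"
proof -
  have image: "\<phi> ` set (leaves s1) \<subseteq> set (leaves t1)" "\<phi> ` set (leaves s2) \<subseteq> set (leaves t2)"
    using \<phi> by (auto dest: realizes_image)
  have disjoint: "set (leaves t1) \<inter> set (leaves t2) = {}" using distinct by simp
  let ?L = "set (leaves (Node s1 s2))"
  have top: "?L \<inter> \<phi> -` (set (leaves t1) \<union> set (leaves t2)) = ?L" using image by auto
  have 1: "?L \<inter> \<phi> -` C = set (leaves s1) \<inter> \<phi> -` C" if "C \<in> clusters t1" for C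
    using clusters_subset[OF that] image disjoint unfolding leaves.simps set_append by blast
  have 2: "?L \<inter> \<phi> -` C = set (leaves s2) \<inter> \<phi> -` C" if "C \<in> clusters t2" for C
    using clusters_subset[OF that] image disjoint unfolding leaves.simps set_append by blast
  have "traces (Node s1 s2) \<phi> (Node t1 t2) =
      insert ?L ((\<lambda>C. ?L \<inter> \<phi> -` C) ` clusters t1 \<union> (\<lambda>C. ?L \<inter> \<phi> -` C) ` clusters t2)"
    unfolding traces_def clusters.simps image_insert image_Un top ..
  also have "\<dots> = insert ?L (traces s1 \<phi> t1 \<union> traces s2 \<phi> t2)"
    using 1 2 by (simp only: traces_def cong: image_cong)
  finally have "insert {} (traces (Node s1 s2) \<phi> (Node t1 t2)) =
      insert ?L (insert {} (traces s1 \<phi> t1) \<union> insert {} (traces s2 \<phi> t2))" by blast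
  also have "\<dots> = insert ?L (insert {} (clusters s1) \<union> insert {} (clusters s2))"
    using \<phi> by (simp only: realizes_def)
  also have "\<dots> = insert {} (clusters (Node s1 s2))" by auto
  finally have traces: "insert {} (traces (Node s1 s2) \<phi> (Node t1 t2)) = insert {} (clusters (Node s1 s2))" .
  have "subseq (map \<phi> (leaves (Node s1 s2))) (leaves (Node t1 t2))"
    unfolding leaves.simps map_append
    by (rule list_emb_append_mono) (use \<phi> in \<open>simp_all only: realizes_def\<close>)
  moreover have "\<forall>x\<in>?L. P x (\<phi> x)"
    unfolding leaves.simps set_append ball_Un using \<phi> by (simp add: realizes_def)
  ultimately show ?thesis unfolding realizes_def using traces by (intro conjI)
qed

text \<open>
  Distinct leaves allow the maps that are obtained from the left and the right subtrees to be glued.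
\<close>

lemma embeds_realized:
  assumes "embeds P s t" "distinct (leaves s)" "distinct (leaves t)"
  shows "\<exists>\<phi>. realizes P \<phi> s t"
  using assms
proof (induction t arbitrary: s)
  case (Leaf b)
  then obtain a where s: "s = Leaf a" "P a b" by (cases s) auto
  then have "realizes P (\<lambda>_. b) s (Leaf b)" by (auto simp: realizes_def traces_def)
  then show ?case by blast
next
  case (Node t1 t2)
  have distinct: "distinct (leaves t1)" "distinct (leaves t2)" using Node.prems by simp_all
  have "embeds P s t1 \<or> embeds P s t2 \<or>
      (\<exists>s1 s2. s = Node s1 s2 \<and> embeds P s1 t1 \<and> embeds P s2 t2)"
    using Node.prems(1) by (cases s) auto
  then consider "embeds P s t1" | "embeds P s t2"
    | s1 s2 where "s = Node s1 s2" "embeds P s1 t1" "embeds P s2 t2" by blast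
  then show ?case
  proof cases
    case 1
    then obtain \<phi> where "realizes P \<phi> s t1" using Node distinct by blast
    then show ?thesis using realizes_descend Node.prems(3) by blast
  next
    case 2
    then obtain \<phi> where "realizes P \<phi> s t2" using Node distinct by blast
    then show ?thesis using realizes_descend Node.prems(3) by blast
  next
    case 3
    have s: "distinct (leaves s1)" "distinct (leaves s2)" "set (leaves s1) \<inter> set (leaves s2) = {}"
      using Node.prems(2) 3(1) by auto
    obtain \<phi>1 where \<phi>1: "realizes P \<phi>1 s1 t1" using Node.IH(1)[OF 3(2) s(1) distinct(1)] by blast
    obtain \<phi>2 where \<phi>2: "realizes P \<phi>2 s2 t2" using Node.IH(2)[OF 3(3) s(2) distinct(2)] by blast
    define \<phi> where "\<phi> x = (if x \<in> set (leaves s1) then \<phi>1 x else \<phi>2 x)" for x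
    have "realizes P \<phi> s1 t1"
      using \<phi>1 realizes_cong[of s1 \<phi> \<phi>1 P t1] by (simp add: \<phi>_def)
    moreover have "\<phi> x = \<phi>2 x" if "x \<in> set (leaves s2)" for x
      using that s(3) by (auto simp: \<phi>_def)
    then have "realizes P \<phi> s2 t2" using \<phi>2 realizes_cong[of s2 \<phi> \<phi>2 P t2] by simp
    ultimately have "realizes P \<phi> s (Node t1 t2)"
      using realizes_Node Node.prems(3) 3(1) by blast
    then show ?thesis by blast
  qed
qed

text \<open>
  Separating two sets in the image of \<open>\<phi>\<close> depends only on the trace of a cluster, and an empty trace
  does not separate nonempty sets.
\<close>

lemma separated_transfer:
  assumes \<phi>: "realizes P \<phi> s t"
    and AB: "A \<subseteq> set (leaves s)" "B \<subseteq> set (leaves s)" "A \<noteq> {}" "B \<noteq> {}"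
  shows "separated (clusters t) (\<phi> ` A) (\<phi> ` B) \<longleftrightarrow> separated (clusters s) A B"
proof -
  define splits where "splits C \<longleftrightarrow> A \<subseteq> C \<and> B \<inter> C = {} \<or> B \<subseteq> C \<and> A \<inter> C = {}" for C
  have empty: "\<not> splits {}" using AB(3,4) by (auto simp: splits_def)
  have "(\<phi> ` A \<subseteq> C \<and> \<phi> ` B \<inter> C = {} \<or> \<phi> ` B \<subseteq> C \<and> \<phi> ` A \<inter> C = {}) \<longleftrightarrow>
      splits (set (leaves s) \<inter> \<phi> -` C)" for C
    using AB(1,2) unfolding splits_def by blast
  then have "separated (clusters t) (\<phi> ` A) (\<phi> ` B) \<longleftrightarrow> (\<exists>D\<in>traces s \<phi> t. splits D)"
    unfolding separated_def traces_def by simp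
  also have "\<dots> \<longleftrightarrow> (\<exists>D\<in>insert {} (traces s \<phi> t). splits D)" using empty by simp
  also have "\<dots> \<longleftrightarrow> (\<exists>D\<in>clusters s. splits D)" using \<phi> empty by (simp add: realizes_def)
  finally show ?thesis unfolding separated_def splits_def .
qed

section \<open>Sides of edges and codes by binary trees\<close>

text \<open>
  Acyclicity enters in the form that every edge is a bridge.  In this form it says that the two sides
  of an edge are disjoint.
\<close>

locale sym_forest =
  fixes E :: "('v \<times> 'v) set"
  assumes sym: "(u, v) \<in> E \<Longrightarrow> (v, u) \<in> E"
    and bridge: "(u, v) \<in> E \<Longrightarrow> (u, v) \<notin> (E - {(u, v), (v, u)})\<^sup>*"
begin

text \<open>
  The component of \<open>v\<close> after the edge between \<open>u\<close> and \<open>v\<close> has been removed.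
\<close>

definition side :: "'v \<Rightarrow> 'v \<Rightarrow> 'v set" where
  "side u v = {c. (v, c) \<in> (E - {(u, v), (v, u)})\<^sup>*}"

lemma side_refl: "v \<in> side u v"
  by (simp add: side_def)

lemma side_step: "c \<in> side u v \<Longrightarrow> (c, d) \<in> E \<Longrightarrow> (c, d) \<noteq> (u, v) \<Longrightarrow> (c, d) \<noteq> (v, u) \<Longrightarrow> d \<in> side u v"
  unfolding side_def mem_Collect_eq by (erule rtrancl_into_rtrancl) simp

lemma side_induct [consumes 1, case_names base step]:
  assumes "c \<in> side u v" "Q v"
    and "\<And>c d. c \<in> side u v \<Longrightarrow> (c, d) \<in> E \<Longrightarrow> (c, d) \<noteq> (u, v) \<Longrightarrow> (c, d) \<noteq> (v, u) \<Longrightarrow> Q c \<Longrightarrow> Q d"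
  shows "Q c"
proof -
  have "(v, c) \<in> (E - {(u, v), (v, u)})\<^sup>*" using assms(1) by (simp add: side_def)
  then show ?thesis
  proof (induction rule: rtrancl_induct)
    case (step c d)
    then show ?case by (intro assms(3)[of c d]) (auto simp: side_def)
  qed (rule assms(2))
qed

lemma side_subset:
  assumes "v \<in> S" "\<And>c d. c \<in> S \<Longrightarrow> (c, d) \<in> E \<Longrightarrow> (c, d) \<noteq> (u, v) \<Longrightarrow> (c, d) \<noteq> (v, u) \<Longrightarrow> d \<in> S"
  shows "side u v \<subseteq> S"
proof
  fix c assume "c \<in> side u v"
  then show "c \<in> S" by (induction rule: side_induct) (use assms in blast)+
qed

lemma side_disjoint:
  assumes "(u, v) \<in> E"
  shows "side u v \<inter> side v u = {}"
proof -
  have "sym (E - {(u, v), (v, u)})" using sym by (auto intro: symI)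
  then have "sym ((E - {(u, v), (v, u)})\<^sup>*)" by (rule sym_rtrancl)
  moreover have "E - {(v, u), (u, v)} = E - {(u, v), (v, u)}" by auto
  ultimately show ?thesis
    using bridge[OF assms] unfolding side_def by (auto dest: symD intro: rtrancl_trans)
qed

lemma source_notin_side: "(u, v) \<in> E \<Longrightarrow> u \<notin> side u v"
  using side_disjoint[of u v] side_refl[of u v] by blast

lemma side_exit: "c \<in> side u v \<Longrightarrow> (c, d) \<in> E \<Longrightarrow> d \<notin> side u v \<Longrightarrow> (c, d) = (v, u)"
  using side_step[of c u v d] side_refl[of v u] by blast

lemma side_cover:
  assumes "(w, v) \<in> E" "(u, v) \<in> E\<^sup>*"
  shows "u \<in> side w v \<union> side v w"
  using assms(2)
proof (induction rule: converse_rtrancl_induct)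
  case base
  then show ?case by (simp add: side_refl)
next
  case (step y z)
  then have "(z, y) \<in> E" by (simp add: sym)
  with step.IH show ?case
    using side_step[of z w v y] side_step[of z v w y] side_refl[of v w] side_refl[of w v] by blast
qed

lemma child_side_subset:
  assumes uv: "(u, v) \<in> E" and va: "(v, a) \<in> E" and "a \<noteq> u"
  shows "side v a \<subseteq> side u v"
proof
  fix c assume "c \<in> side v a"
  then show "c \<in> side u v"
  proof (induction rule: side_induct)
    case base
    then show ?case using va \<open>a \<noteq> u\<close> side_refl[of v u] source_notin_side[OF uv]
      by (intro side_step[of v u v a]) auto
  next
    case (step c d)
    have "c \<noteq> u" using step.IH source_notin_side[OF uv] by blast
    moreover have "c \<noteq> v" using step.hyps source_notin_side[OF va] by blast
    ultimately show ?case using step by (intro side_step[of c u v d]) auto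
  qed
qed

lemma children_disjoint:
  assumes va: "(v, a) \<in> E" and vb: "(v, b) \<in> E" and "a \<noteq> b"
  shows "side v a \<inter> side v b = {}"
proof -
  have "side v b \<subseteq> side a v"
    using child_side_subset[of a v b] va vb sym \<open>a \<noteq> b\<close> by blast
  then show ?thesis using side_disjoint[OF va] by blast
qed

text \<open>
  The recursion by which an arc \<open>(u, v)\<close> is turned into a binary tree: below \<open>v\<close> lie the sides of the
  other arcs that leave \<open>v\<close>.
\<close>

lemma side_decompose:
  assumes uv: "(u, v) \<in> E"
  shows "side u v = insert v (\<Union>a \<in> E `` {v} - {u}. side v a)"
proof
  show "insert v (\<Union>a \<in> E `` {v} - {u}. side v a) \<subseteq> side u v"
    using child_side_subset[OF uv] side_refl[of v u] by blast
  show "side u v \<subseteq> insert v (\<Union>a \<in> E `` {v} - {u}. side v a)"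
  proof (rule side_subset)
    fix c d
    assume c: "c \<in> insert v (\<Union>a \<in> E `` {v} - {u}. side v a)"
      and cd: "(c, d) \<in> E" "(c, d) \<noteq> (v, u)"
    show "d \<in> insert v (\<Union>a \<in> E `` {v} - {u}. side v a)"
    proof (cases "c = v")
      case True
      then show ?thesis using cd side_refl[of d v] by blast
    next
      case False
      then obtain a where a: "(v, a) \<in> E" "a \<noteq> u" "c \<in> side v a" using c by blast
      then show ?thesis using side_exit[OF a(3) cd(1)] by blast
    qed
  qed simp
qed

lemma crossing:
  assumes "successively (\<lambda>a b. (a, b) \<in> E) xs" "xs \<noteq> []" "hd xs \<in> S" "last xs \<notin> S"
  shows "\<exists>a b. a \<in> set xs \<and> b \<in> set xs \<and> (a, b) \<in> E \<and> a \<in> S \<and> b \<notin> S"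
  using assms
proof (induction xs)
  case (Cons x xs)
  show ?case
  proof (cases "xs = [] \<or> hd xs \<notin> S")
    case True
    then show ?thesis using Cons.prems by (cases xs) auto
  next
    case False
    then show ?thesis using Cons by (cases xs) auto
  qed
qed simp

text \<open>
  A path that leaves the side of \<open>(p, q)\<close> and returns to it would visit \<open>q\<close> twice, since the only
  exit and the only entrance lead through the edge between \<open>p\<close> and \<open>q\<close>.
\<close>

lemma path_in_side:
  assumes pq: "(p, q) \<in> E"
    and xs: "successively (\<lambda>a b. (a, b) \<in> E) xs" "xs \<noteq> []" "distinct xs"
    and ends: "hd xs \<in> side p q" "last xs \<in> side p q"
  shows "set xs \<subseteq> side p q"
proof (rule ccontr)
  assume "\<not> ?thesis"
  then obtain c where c: "c \<in> set xs" "c \<notin> side p q" by blast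
  then obtain ys zs where split: "xs = ys @ c # zs" by (meson split_list)
  have suc: "successively (\<lambda>a b. (a, b) \<in> E) (ys @ [c])" "successively (\<lambda>a b. (a, b) \<in> E) (c # zs)"
    using xs(1) unfolding split by (auto simp: successively_append_iff)
  have "\<exists>a b. a \<in> set (ys @ [c]) \<and> b \<in> set (ys @ [c]) \<and> (a, b) \<in> E \<and> a \<in> side p q \<and> b \<notin> side p q"
    using suc(1) ends(1) c(2) by (intro crossing) (auto simp: split hd_append)
  then have 1: "q \<in> set (ys @ [c])" using side_exit[of _ p q] by blast
  have "\<exists>a b. a \<in> set (c # zs) \<and> b \<in> set (c # zs) \<and> (a, b) \<in> E \<and> a \<in> - side p q \<and> b \<notin> - side p q"
    using suc(2) ends(2) c(2) by (intro crossing) (auto simp: split)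
  then have 2: "q \<in> set (c # zs)" using side_exit[of _ p q] sym by blast
  have "q \<noteq> c" using c(2) side_refl[of q p] by blast
  with 1 2 xs(3) show False unfolding split by auto
qed

text \<open>
  For every edge at or beyond \<open>v\<close>, one of its two sides has to occur as a cluster.  Which one is
  left open, as a cluster and its complement separate the same leaves.
\<close>

definition encodes_side :: "'v set \<Rightarrow> 'v btree \<Rightarrow> 'v \<Rightarrow> 'v \<Rightarrow> bool" where
  "encodes_side H t u v \<longleftrightarrow> distinct (leaves t) \<and> set (leaves t) = side u v \<inter> H \<and>
     clusters t \<subseteq> {side p q \<inter> H | p q. (p, q) \<in> E} \<and>
     (\<forall>p q. (p, q) \<in> E \<longrightarrow> q \<in> side u v \<longrightarrow> side p q \<inter> H \<in> clusters t \<or> side q p \<inter> H \<in> clusters t)"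

lemma finite_side:
  assumes "finite E"
  shows "finite (side u v)"
proof (rule finite_subset)
  show "side u v \<subseteq> insert v (snd ` E)"
    by (rule side_subset) force+
qed (use assms in simp)

lemma encodes_Leaf:
  assumes vu: "(u, v) \<in> E" and v: "v \<in> H" "E `` {v} = {u}"
  shows "encodes_side H (Leaf v) u v"
proof -
  have side: "side u v = {v}" using side_decompose[OF vu] v(2) by simp
  have leaf: "side u v \<inter> H = {v}" using side v(1) by simp
  show ?thesis
    unfolding encodes_side_def
  proof (intro conjI allI impI)
    show "clusters (Leaf v) \<subseteq> {side p q \<inter> H | p q. (p, q) \<in> E}"
      using leaf vu by (simp, metis)
    fix p q
    assume "(p, q) \<in> E" "q \<in> side u v"
    then have "p = u" "q = v" using sym[of p q] v(2) side by auto
    then show "side p q \<inter> H \<in> clusters (Leaf v) \<or> side q p \<inter> H \<in> clusters (Leaf v)"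
      using leaf by simp
  qed (use leaf in simp_all)
qed

lemma encodes_Node:
  assumes uv: "(u, v) \<in> E" and v: "v \<notin> H" "E `` {v} = {u, a, b}" "a \<noteq> b" "a \<noteq> u" "b \<noteq> u"
    and s: "encodes_side H s v a" and t: "encodes_side H t v b"
  shows "encodes_side H (Node s t) u v"
proof -
  have va: "(v, a) \<in> E" and vb: "(v, b) \<in> E" using v(2) by auto
  have side: "side u v = insert v (side v a \<union> side v b)"
    using side_decompose[OF uv] v by auto
  have disjoint: "side v a \<inter> side v b = {}" using va vb v(3) by (rule children_disjoint)
  have leaves: "set (leaves s) = side v a \<inter> H" "set (leaves t) = side v b \<inter> H"
    "distinct (leaves s)" "distinct (leaves t)"
    using s t by (simp_all add: encodes_side_def)
  have top: "set (leaves s) \<union> set (leaves t) = side u v \<inter> H"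
    using side leaves v(1) by auto
  have complete: "side p q \<inter> H \<in> clusters (Node s t) \<or> side q p \<inter> H \<in> clusters (Node s t)"
    if pq: "(p, q) \<in> E" "q \<in> side u v" for p q
  proof -
    have s_complete: "side p q \<inter> H \<in> clusters s \<or> side q p \<inter> H \<in> clusters s"
      if "(p, q) \<in> E" "q \<in> side v a" for p q
      using s that unfolding encodes_side_def by blast
    have t_complete: "side p q \<inter> H \<in> clusters t \<or> side q p \<inter> H \<in> clusters t"
      if "(p, q) \<in> E" "q \<in> side v b" for p q
      using t that unfolding encodes_side_def by blast
    have "p \<in> E `` {v}" if "q = v" using sym[OF pq(1)] that by simp
    then have "p \<in> {u, a, b}" if "q = v" using that v(2) by simp
    moreover have "q = v \<or> q \<in> side v a \<or> q \<in> side v b" using pq(2) side by simp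
    ultimately consider "q = v" "p = u" | "q = v" "p = a" | "q = v" "p = b" | "q \<in> side v a" | "q \<in> side v b"
      by auto
    then show ?thesis
    proof cases
      case 1
      then show ?thesis using top by simp
    next
      case 2
      then show ?thesis using s_complete[OF va side_refl] by auto
    next
      case 3
      then show ?thesis using t_complete[OF vb side_refl] by auto
    next
      case 4
      then show ?thesis using s_complete[OF pq(1)] by auto
    next
      case 5
      then show ?thesis using t_complete[OF pq(1)] by auto
    qed
  qed
  have "clusters s \<union> clusters t \<subseteq> {side p q \<inter> H | p q. (p, q) \<in> E}"
    using s t by (simp add: encodes_side_def)
  then have "clusters (Node s t) \<subseteq> {side p q \<inter> H | p q. (p, q) \<in> E}"
    using top uv by auto
  moreover have "distinct (leaves (Node s t))" using leaves disjoint by auto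
  ultimately show ?thesis
    using top complete unfolding encodes_side_def by simp
qed

text \<open>
  By recursion on the size of the side: the side of \<open>(u, v)\<close> properly contains the sides of the arcs
  from \<open>v\<close> to its other two neighbours.
\<close>

lemma side_has_code:
  assumes "finite E"
    and deg: "\<And>u v. (u, v) \<in> E \<Longrightarrow> v \<in> H \<and> E `` {v} = {u} \<or>
      v \<notin> H \<and> (\<exists>a b. E `` {v} = {u, a, b} \<and> a \<noteq> b \<and> a \<noteq> u \<and> b \<noteq> u)"
  shows "(u, v) \<in> E \<Longrightarrow> \<exists>t. encodes_side H t u v"
proof (induction "card (side u v)" arbitrary: u v rule: less_induct)
  case less
  show ?case
  proof (cases "v \<in> H")
    case True
    then show ?thesis using deg[OF less.prems] encodes_Leaf[OF less.prems] by blast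
  next
    case False
    then obtain a b where v: "E `` {v} = {u, a, b}" "a \<noteq> b" "a \<noteq> u" "b \<noteq> u"
      using deg[OF less.prems] by blast
    have child: "\<exists>t. encodes_side H t v c" if "c \<in> {a, b}" for c
    proof (rule less.hyps)
      show vc: "(v, c) \<in> E" using that v(1) by blast
      have "side v c \<subseteq> side u v" using child_side_subset[OF less.prems vc] that v by blast
      then have "side v c \<subset> side u v" using source_notin_side[OF vc] side_refl[of v u] by blast
      then show "card (side v c) < card (side u v)"
        using finite_side[OF assms(1)] by (rule psubset_card_mono[rotated])
    qed
    then obtain s t where "encodes_side H s v a" "encodes_side H t v b" by blast
    then show ?thesis using encodes_Node[OF less.prems False v] by blast
  qed
qed

text \<open>
  On the way from \<open>G\<close> to \<open>G'\<close> the last arc that leaves \<open>G\<close> does the job: inside \<open>G\<close> and inside \<open>G'\<close>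
  one never needs this arc, nor does one on the rest of the way.
\<close>

lemma separating_arc:
  assumes disjoint: "G \<inter> G' = {}" and "w \<in> G" "y \<in> G'" and wy: "(w, y) \<in> E\<^sup>*"
    and G: "\<And>c d. c \<in> G \<Longrightarrow> d \<in> G \<Longrightarrow> (c, d) \<in> (E \<inter> G \<times> G)\<^sup>*"
    and G': "\<And>c d. c \<in> G' \<Longrightarrow> d \<in> G' \<Longrightarrow> (c, d) \<in> (E \<inter> G' \<times> G')\<^sup>*"
  shows "\<exists>p q. (p, q) \<in> E \<and> G \<subseteq> side p q \<and> G' \<subseteq> side q p"
proof -
  have "y \<notin> G" using disjoint \<open>y \<in> G'\<close> by blast
  have "w \<in> G \<longrightarrow> (\<exists>q p. q \<in> G \<and> p \<notin> G \<and> (q, p) \<in> E \<and> (p, y) \<in> (E \<inter> (- G) \<times> (- G))\<^sup>*)"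
    if "(w, y) \<in> E\<^sup>*" for w
  proof -
    have "(w \<notin> G \<and> (w, y) \<in> (E \<inter> (- G) \<times> (- G))\<^sup>*) \<or>
        (\<exists>q p. q \<in> G \<and> p \<notin> G \<and> (q, p) \<in> E \<and> (p, y) \<in> (E \<inter> (- G) \<times> (- G))\<^sup>*)"
      using that
    proof (induction rule: converse_rtrancl_induct)
      case base
      then show ?case using \<open>y \<notin> G\<close> by blast
    next
      case (step c d)
      then show ?case by (blast intro: converse_rtrancl_into_rtrancl)
    qed
    then show ?thesis by blast
  qed
  then obtain q p where qp: "q \<in> G" "p \<notin> G" "(q, p) \<in> E" "(p, y) \<in> (E \<inter> (- G) \<times> (- G))\<^sup>*"
    using wy \<open>w \<in> G\<close> by blast
  have 1: "c \<in> side p q" if "c \<in> G" for c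
  proof -
    have "(E \<inter> G \<times> G)\<^sup>* \<subseteq> (E - {(p, q), (q, p)})\<^sup>*" by (rule rtrancl_mono) (use qp in auto)
    then show ?thesis using G[OF qp(1) that] unfolding side_def by blast
  qed
  have 2: "c \<in> side q p" if "c \<in> G'" for c
  proof -
    have "(E \<inter> G' \<times> G')\<^sup>* \<subseteq> (E - {(q, p), (p, q)})\<^sup>*"
      by (rule rtrancl_mono) (use qp disjoint in auto)
    moreover have "(E \<inter> (- G) \<times> (- G))\<^sup>* \<subseteq> (E - {(q, p), (p, q)})\<^sup>*"
      by (rule rtrancl_mono) (use qp in auto)
    ultimately show ?thesis
      using G'[OF \<open>y \<in> G'\<close> that] qp(4) unfolding side_def by (blast intro: rtrancl_trans)
  qed
  show ?thesis using 1 2 sym[OF qp(3)] by blast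
qed

lemma path_connected:
  assumes "successively (\<lambda>a b. (a, b) \<in> E) xs" "c \<in> set xs" "set xs \<subseteq> G"
  shows "(hd xs, c) \<in> (E \<inter> G \<times> G)\<^sup>*"
  using assms
proof (induction xs)
  case (Cons x xs)
  then show ?case
    by (cases xs) (auto intro: converse_rtrancl_into_rtrancl)
qed simp

end

section \<open>Geodesics and codes of boron trees\<close>

lemma walk_vertices:
  assumes "pcas u p v" "set p \<subseteq> E"
  shows "successively (\<lambda>a b. (a, b) \<in> E) (pawalk_verts u p) \<and>
    pawalk_verts u p \<noteq> [] \<and> hd (pawalk_verts u p) = u \<and> last (pawalk_verts u p) = v"
  using assms
proof (induction p arbitrary: u)
  case (Cons e p)
  then have "successively (\<lambda>a b. (a, b) \<in> E) (pawalk_verts (snd e) p) \<and>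
    pawalk_verts (snd e) p \<noteq> [] \<and> hd (pawalk_verts (snd e) p) = snd e \<and> last (pawalk_verts (snd e) p) = v"
    by simp
  then show ?case using Cons.prems
    by (cases "pawalk_verts (snd e) p") (auto simp: successively_Cons)
qed simp

lemma geodesic_path:
  assumes "pair_wf_digraph T" "c \<in> geodesic T x y"
  obtains xs where "successively (\<lambda>a b. (a, b) \<in> parcs T) xs" "xs \<noteq> []" "distinct xs" "hd xs = x"
    "last xs = y" "c \<in> set xs" "set xs \<subseteq> geodesic T x y"
proof -
  interpret pair_wf_digraph T by fact
  obtain p where p: "apath x p y" "c \<in> set (pawalk_verts x p)"
    using assms(2) unfolding geodesic_def by blast
  show ?thesis
  proof (rule that)
    show "set (pawalk_verts x p) \<subseteq> geodesic T x y" using p(1) unfolding geodesic_def by blast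
  qed (use p walk_vertices[of x p y "parcs T"] in \<open>auto simp: apath_def awalk_def\<close>)
qed

text \<open>
  If \<open>v\<close> can be reached from \<open>u\<close> without the edge between them, then a path of this kind has length at
  least two and is closed to a cycle by this edge.
\<close>

lemma undirected_tree_arc_is_bridge:
  assumes T: "undirected_tree T" and uv: "(u, v) \<in> parcs T"
  shows "(u, v) \<notin> (parcs T - {(u, v), (v, u)})\<^sup>*"
proof
  assume conn: "(u, v) \<in> (parcs T - {(u, v), (v, u)})\<^sup>*"
  interpret pair_graph T using T by (simp add: undirected_tree_def)
  define H where "H = \<lparr>pverts = pverts T, parcs = parcs T - {(u, v), (v, u)}\<rparr>"
  interpret H: pair_wf_digraph H
    by unfold_locales (auto simp: H_def dest: wellformed')
  have "u \<rightarrow>\<^sup>*\<^bsub>H\<^esub> v"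
    using conn
  proof (induction rule: rtrancl_induct)
    case base
    have "u \<in> pverts H" using in_arcsD1[OF uv] by (simp add: H_def)
    then show ?case by (rule H.reachable_refl)
  next
    case (step y z)
    from step.IH show ?case
      by (rule H.reachable_adj_trans) (use step.hyps in \<open>simp add: H_def\<close>)
  qed
  then obtain p where p: "H.apath u p v" using H.reachable_apath by blast
  then have p': "pcas u p v" "set p \<subseteq> parcs H" "distinct (pawalk_verts u p)"
    by (simp_all add: H.apath_def H.awalk_def)
  then have arcs: "set p \<subseteq> parcs T" "(u, v) \<notin> set p" by (auto simp: H_def)
  have "u \<noteq> v" using pair_no_loops[OF uv] by simp
  have "p \<noteq> []" using p'(1) \<open>u \<noteq> v\<close> by auto
  moreover have "p \<noteq> [e]" for e using p'(1) arcs(2) by (cases e) auto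
  ultimately have "2 \<le> length p" by (cases p rule: remdups_adj.cases) auto
  moreover have "cycle ((v, u) # p)"
  proof -
    have "(v, u) \<in> parcs T" using uv arcs_ends_symmetric[OF sym_arcs] by simp
    then have "awalk v ((v, u) # p) v"
      using p'(1) arcs(1) in_arcsD2[OF uv] by (simp add: awalk_def)
    then show ?thesis using p'(3) by (auto simp: cycle_def)
  qed
  ultimately have "\<exists>p. cycle p \<and> 3 \<le> length p" by (intro exI[of _ "(v, u) # p"]) simp
  then show False using T by (simp add: undirected_tree_def)
qed

lemma out_degree_card: "out_degree (with_proj T) v = card (parcs T `` {v})"
proof -
  have "out_arcs (with_proj T) v = Pair v ` (parcs T `` {v})" by (auto simp: out_arcs_def)
  then show ?thesis by (simp add: out_degree_def card_image inj_on_def)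
qed

text \<open>
  A rooted and ordered version of \<open>T\<close>, kept only as a tree of hydrogen atoms together with the
  condition that its clusters determine \<open>\<rho>\<close>.
\<close>

definition tree_code :: "'v pair_pre_digraph \<Rightarrow> 'v btree \<Rightarrow> bool" where
  "tree_code T t \<longleftrightarrow> distinct (leaves t) \<and> set (leaves t) = hydrogen T \<and>
    (\<forall>w\<in>hydrogen T. \<forall>x\<in>hydrogen T. \<forall>y\<in>hydrogen T. \<forall>z\<in>hydrogen T.
       rho T w x y z \<longleftrightarrow> \<not> separated (clusters t) {w, x} {y, z})"

text \<open>
  The root is put on an arbitrary edge \<open>(u, v)\<close>, whose two sides become the two subtrees.  The
  relation \<open>\<rho>\<close> is recovered because two geodesics are disjoint if and only if some edge separates
  them: a geodesic with both ends on one side of an edge stays there, and conversely two disjoint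
  connected sets are separated by an edge.
\<close>

theorem boron_tree_has_code:
  assumes T: "boron_tree T"
  shows "\<exists>t. tree_code T t"
proof -
  define E where "E = parcs T"
  define H where "H = hydrogen T"
  have tree: "undirected_tree T" using T by (simp add: boron_tree_def)
  interpret pair_graph T using tree by (simp add: undirected_tree_def)
  interpret t: sym_forest E
  proof
    show "(v, u) \<in> E" if "(u, v) \<in> E" for u v
      using that arcs_ends_symmetric[OF sym_arcs] by (simp add: E_def)
    show "(u, v) \<notin> (E - {(u, v), (v, u)})\<^sup>*" if "(u, v) \<in> E" for u v
      using undirected_tree_arc_is_bridge[OF tree] that by (simp add: E_def)
  qed
  have "Digraph_Component.connected (with_proj T)" using tree by (simp add: undirected_tree_def)
  then have strong: "strongly_connected (with_proj T)"
    by (rule symmetric_connected_imp_strongly_connected[OF sym_arcs])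
  then have reach: "u \<rightarrow>\<^sup>*\<^bsub>T\<^esub> v" if "u \<in> pverts T" "v \<in> pverts T" for u v
    using that by (auto simp: strongly_connected_def)
  then have conn: "(u, v) \<in> E\<^sup>*" if "u \<in> pverts T" "v \<in> pverts T" for u v
    using that reachable_rtranclI[of "with_proj T" u v] by (simp add: E_def)
  have H_V: "H \<subseteq> pverts T" by (auto simp: H_def hydrogen_def)
  have wf: "pair_wf_digraph T" by unfold_locales
  have ends: "w \<in> geodesic T w x" if wx: "w \<in> pverts T" "x \<in> pverts T" for w x
  proof -
    obtain p where p: "apath w p x" using reach[OF wx] reachable_apath by blast
    have "w \<in> set (pawalk_verts w p)" by (cases p) (use p in \<open>auto simp: apath_def awalk_def\<close>)
    then show ?thesis using p unfolding geodesic_def by blast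
  qed
  have rho: "\<not> rho T w x y z \<longleftrightarrow> (\<exists>p q. (p, q) \<in> E \<and> {w, x} \<subseteq> t.side p q \<and> {y, z} \<subseteq> t.side q p)"
    if V: "w \<in> pverts T" "x \<in> pverts T" "y \<in> pverts T" "z \<in> pverts T" for w x y z
  proof
    assume disjoint: "\<not> rho T w x y z"
    have "(c, d) \<in> (E \<inter> geodesic T u v \<times> geodesic T u v)\<^sup>*"
      if "c \<in> geodesic T u v" "d \<in> geodesic T u v" for u v c d
    proof -
      have from_u: "(u, c) \<in> (E \<inter> geodesic T u v \<times> geodesic T u v)\<^sup>*" if c: "c \<in> geodesic T u v" for c
        using geodesic_path[OF wf c] t.path_connected by (metis E_def)
      have "Relation.sym ((E \<inter> geodesic T u v \<times> geodesic T u v)\<^sup>*)"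
        by (intro sym_rtrancl symI) (auto intro: t.sym)
      then show ?thesis using from_u that by (meson rtrancl_trans symD)
    qed
    note G = this
    have "\<exists>p q. (p, q) \<in> E \<and> geodesic T w x \<subseteq> t.side p q \<and> geodesic T y z \<subseteq> t.side q p"
    proof (rule t.separating_arc)
      show "geodesic T w x \<inter> geodesic T y z = {}" using disjoint by (simp add: rho_def)
    qed (use V ends conn G in auto)
    moreover have "x \<in> geodesic T w x" "z \<in> geodesic T y z"
    proof -
      have target: "v \<in> geodesic T u v" if uv: "u \<in> pverts T" "v \<in> pverts T" for u v
      proof -
        obtain xs where "hd xs = u" "last xs = v" "xs \<noteq> []" "set xs \<subseteq> geodesic T u v"
          using geodesic_path[OF wf ends[OF uv]] by metis
        then show ?thesis using last_in_set by blast
      qed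
      show "x \<in> geodesic T w x" "z \<in> geodesic T y z" using V target by auto
    qed
    ultimately show "\<exists>p q. (p, q) \<in> E \<and> {w, x} \<subseteq> t.side p q \<and> {y, z} \<subseteq> t.side q p"
      using V ends by blast
  next
    assume "\<exists>p q. (p, q) \<in> E \<and> {w, x} \<subseteq> t.side p q \<and> {y, z} \<subseteq> t.side q p"
    then obtain p q where pq: "(p, q) \<in> E" "{w, x} \<subseteq> t.side p q" "{y, z} \<subseteq> t.side q p" by blast
    have inside: "geodesic T u v \<subseteq> t.side p q" if pq: "(p, q) \<in> E" "{u, v} \<subseteq> t.side p q" for u v p q
    proof
      fix c assume "c \<in> geodesic T u v"
      then obtain xs where xs: "successively (\<lambda>a b. (a, b) \<in> E) xs" "xs \<noteq> []" "distinct xs" "hd xs = u"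
        "last xs = v" "c \<in> set xs"
        using geodesic_path[OF wf] by (metis E_def)
      then show "c \<in> t.side p q" using t.path_in_side[OF pq(1) xs(1-3)] pq(2) by auto
    qed
    have "geodesic T w x \<inter> geodesic T y z \<subseteq> t.side p q \<inter> t.side q p"
      using inside[OF pq(1,2)] inside[OF t.sym[OF pq(1)] pq(3)] by blast
    then show "\<not> rho T w x y z" using t.side_disjoint[OF pq(1)] by (simp add: rho_def)
  qed
  show ?thesis
  proof (cases "E = {}")
    case True
    obtain v where "v \<in> pverts T" using strong by (auto simp: strongly_connected_def)
    moreover have "u = v" if "u \<in> pverts T" "v \<in> pverts T" for u v
      using conn[OF that] True by simp
    ultimately have V: "pverts T = {v}" by blast
    have H: "H = {v}" using V True by (auto simp: H_def hydrogen_def out_degree_card E_def)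
    have "rho T v v v v" using rho[of v v v v] V True by simp
    then have "tree_code T (Leaf v)"
      using H by (simp add: tree_code_def separated_def H_def)
    then show ?thesis by blast
  next
    case False
    have deg: "v \<in> H \<and> E `` {v} = {u} \<or>
        v \<notin> H \<and> (\<exists>a b. E `` {v} = {u, a, b} \<and> a \<noteq> b \<and> a \<noteq> u \<and> b \<noteq> u)"
      if uv: "(u, v) \<in> E" for u v
    proof -
      have u: "u \<in> E `` {v}" using t.sym[OF uv] by blast
      have v: "v \<in> pverts T" using uv wellformed' by (simp add: E_def)
      have fin: "finite (E `` {v})" using pair_finite_arcs by (simp add: E_def finite_Image)
      show ?thesis
      proof (cases "v \<in> H")
        case True
        then have "card (E `` {v}) \<le> 1" by (simp add: H_def hydrogen_def out_degree_card E_def)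
        then have "E `` {v} = {u}" using u fin by (auto simp: card_le_Suc0_iff_eq)
        then show ?thesis using True by simp
      next
        case False
        then have "card (E `` {v}) = 3"
          using T v by (simp add: boron_tree_def H_def out_degree_card E_def)
        then have "card (E `` {v} - {u}) = 2" using u fin by simp
        then obtain a b where "E `` {v} - {u} = {a, b}" "a \<noteq> b" by (auto simp: card_2_iff)
        then have "E `` {v} = {u, a, b} \<and> a \<noteq> b \<and> a \<noteq> u \<and> b \<noteq> u" using u by blast
        then show ?thesis using False by blast
      qed
    qed
    have fin: "finite E" using pair_finite_arcs by (simp add: E_def)
    obtain u v where uv: "(u, v) \<in> E" using False by auto
    obtain s where s: "t.encodes_side H s u v" using t.side_has_code[OF fin deg uv] by blast
    obtain s' where s': "t.encodes_side H s' v u"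
      using t.side_has_code[OF fin deg t.sym[OF uv]] by blast
    have V: "c \<in> t.side p q \<union> t.side q p" if "(p, q) \<in> E" "c \<in> pverts T" for p q c
      using t.side_cover[OF that(1) conn[of c q]] that wellformed' by (auto simp: E_def)
    have leaves: "set (leaves (Node s s')) = H"
      using s s' V[OF uv] H_V by (auto simp: t.encodes_side_def)
    have distinct: "distinct (leaves (Node s s'))"
      using s s' t.side_disjoint[OF uv] by (auto simp: t.encodes_side_def)
    have complete: "t.side p q \<inter> H \<in> clusters (Node s s') \<or> t.side q p \<inter> H \<in> clusters (Node s s')"
      if pq: "(p, q) \<in> E" for p q
    proof -
      have "q \<in> pverts T" using pq wellformed' by (simp add: E_def)
      then have "q \<in> t.side u v \<or> q \<in> t.side v u" using V[OF uv] by blast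
      then show ?thesis using s s' pq unfolding t.encodes_side_def by auto
    qed
    \<comment> \<open>The cluster at the root is the only one that does not come from an edge of \<open>T\<close>.\<close>
    have sound: "C = H \<or> (\<exists>p q. (p, q) \<in> E \<and> C = t.side p q \<inter> H)" if "C \<in> clusters (Node s s')" for C
    proof -
      have "C = H \<or> C \<in> clusters s \<union> clusters s'" using that leaves by auto
      moreover have "clusters s \<union> clusters s' \<subseteq> {t.side p q \<inter> H | p q. (p, q) \<in> E}"
        using s s' by (simp add: t.encodes_side_def)
      ultimately show ?thesis by blast
    qed
    have "rho T w x y z \<longleftrightarrow> \<not> separated (clusters (Node s s')) {w, x} {y, z}"
      if H: "w \<in> H" "x \<in> H" "y \<in> H" "z \<in> H" for w x y z
    proof -
      have "separated (clusters (Node s s')) {w, x} {y, z} \<longleftrightarrow>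
          (\<exists>p q. (p, q) \<in> E \<and> {w, x} \<subseteq> t.side p q \<and> {y, z} \<subseteq> t.side q p)"
      proof
        assume "separated (clusters (Node s s')) {w, x} {y, z}"
        then obtain C where C: "C \<in> clusters (Node s s')"
          "{w, x} \<subseteq> C \<and> {y, z} \<inter> C = {} \<or> {y, z} \<subseteq> C \<and> {w, x} \<inter> C = {}"
          unfolding separated_def by blast
        have "C \<noteq> H" using C(2) H by blast
        then obtain p q where pq: "(p, q) \<in> E" "C = t.side p q \<inter> H" using sound[OF C(1)] by blast
        have "c \<in> t.side q p" if "c \<in> H" "c \<notin> C" for c using V[OF pq(1)] pq(2) that H_V by blast
        then have "{w, x} \<subseteq> t.side p q \<and> {y, z} \<subseteq> t.side q p \<or> {y, z} \<subseteq> t.side p q \<and> {w, x} \<subseteq> t.side q p"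
          using C(2) H pq(2) by blast
        then show "\<exists>p q. (p, q) \<in> E \<and> {w, x} \<subseteq> t.side p q \<and> {y, z} \<subseteq> t.side q p"
          using pq(1) t.sym[OF pq(1)] by blast
      next
        assume "\<exists>p q. (p, q) \<in> E \<and> {w, x} \<subseteq> t.side p q \<and> {y, z} \<subseteq> t.side q p"
        then obtain p q where pq: "(p, q) \<in> E" "{w, x} \<subseteq> t.side p q" "{y, z} \<subseteq> t.side q p" by blast
        have "t.side p q \<inter> t.side q p = {}" using pq(1) by (rule t.side_disjoint)
        then have "{w, x} \<subseteq> t.side p q \<inter> H \<and> {y, z} \<inter> (t.side p q \<inter> H) = {}"
          "{y, z} \<subseteq> t.side q p \<inter> H \<and> {w, x} \<inter> (t.side q p \<inter> H) = {}"
          using pq H by blast+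
        then show "separated (clusters (Node s s')) {w, x} {y, z}"
          using complete[OF pq(1)] unfolding separated_def by blast
      qed
      then show ?thesis using rho[of w x y z] H H_V by blast
    qed
    then have "tree_code T (Node s s')"
      using leaves distinct unfolding tree_code_def H_def by blast
    then show ?thesis by blast
  qed
qed

section \<open>Leading monomials\<close>

fun lex_less :: "'v list \<Rightarrow> ('v \<Rightarrow> nat) \<Rightarrow> ('v \<Rightarrow> nat) \<Rightarrow> bool" where
  "lex_less [] a b \<longleftrightarrow> False"
| "lex_less (x # xs) a b \<longleftrightarrow> a x < b x \<or> a x = b x \<and> lex_less xs a b"

lemma lex_less_irrefl: "\<not> lex_less xs a a"
  by (induction xs) auto

lemma lex_less_trans: "lex_less xs a b \<Longrightarrow> lex_less xs b c \<Longrightarrow> lex_less xs a c"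
  by (induction xs) auto

lemma lex_less_total: "lex_less xs a b \<or> lex_less xs b a \<or> (\<forall>x\<in>set xs. a x = b x)"
  by (induction xs) auto

lemma lex_less_add: "lex_less xs (\<lambda>x. c x + a x) (\<lambda>x. c x + b x) \<longleftrightarrow> lex_less xs a b"
  by (induction xs) auto

lemma lex_less_map: "lex_less (map \<phi> xs) a b \<longleftrightarrow> lex_less xs (a \<circ> \<phi>) (b \<circ> \<phi>)"
  by (induction xs) auto

lemma lex_less_cong:
  "(\<And>x. x \<in> set xs \<Longrightarrow> a x = a' x \<and> b x = b' x) \<Longrightarrow> lex_less xs a b \<longleftrightarrow> lex_less xs a' b'"
  by (induction xs) auto

lemma lex_less_subseq:
  assumes "subseq xs ys" "distinct ys" "\<And>y. y \<in> set ys - set xs \<Longrightarrow> a y = b y" "lex_less xs a b"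
  shows "lex_less ys a b"
  using assms
proof (induction rule: list_emb.induct)
  case (list_emb_Cons xs ys y)
  then have "y \<notin> set xs" by (auto dest: subseq_set_subset)
  then show ?case using list_emb_Cons by simp
next
  case (list_emb_Cons2 x y xs ys)
  then have "y \<notin> set xs" by (auto dest: subseq_set_subset)
  then have "lex_less ys a b" if "lex_less xs a b"
    using list_emb_Cons2 that by (intro list_emb_Cons2.IH) auto
  then show ?case using list_emb_Cons2 by auto
qed simp

lemma wf_lex_less: "wf {(a, b). lex_less xs a b}"
proof (induction xs)
  case (Cons x xs)
  have "{(a, b). lex_less (x # xs) a b} =
      inv_image (less_than <*lex*> {(a, b). lex_less xs a b}) (\<lambda>a. (a x, a))"
    by auto
  then show ?case using Cons.IH by (simp add: wf_lex_prod wf_inv_image)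
qed simp

abbreviation monomial_less :: "'v list \<Rightarrow> ('v \<Rightarrow>\<^sub>0 nat) \<Rightarrow> ('v \<Rightarrow>\<^sub>0 nat) \<Rightarrow> bool" where
  "monomial_less L m m' \<equiv> lex_less L (Poly_Mapping.lookup m) (Poly_Mapping.lookup m')"

definition leading :: "'v list \<Rightarrow> 'v cpoly \<Rightarrow> ('v \<Rightarrow>\<^sub>0 nat) \<Rightarrow> bool" where
  "leading L f m \<longleftrightarrow> m \<in> Poly_Mapping.keys f \<and> (\<forall>m'\<in>Poly_Mapping.keys f. m' \<noteq> m \<longrightarrow> monomial_less L m' m)"

lemma monomial_less_total:
  assumes "Poly_Mapping.keys m \<subseteq> set L" "Poly_Mapping.keys m' \<subseteq> set L" "m \<noteq> m'"
  shows "monomial_less L m m' \<or> monomial_less L m' m"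
proof -
  have "m = m'" if "\<forall>x\<in>set L. Poly_Mapping.lookup m x = Poly_Mapping.lookup m' x"
  proof (rule poly_mapping_eqI)
    fix x
    show "Poly_Mapping.lookup m x = Poly_Mapping.lookup m' x"
      using that assms(1,2) by (metis in_keys_iff subsetD)
  qed
  then show ?thesis using lex_less_total assms(3) by blast
qed

lemma leading_exists:
  assumes "f \<noteq> 0" and "f \<in> carrier (poly_ring_over (set L))"
  shows "\<exists>m. leading L f m"
proof -
  have "\<exists>m\<in>A. \<forall>m'\<in>A. m' \<noteq> m \<longrightarrow> monomial_less L m' m"
    if "finite A" "A \<noteq> {}" "\<forall>m\<in>A. Poly_Mapping.keys m \<subseteq> set L" for A
    using that
  proof (induction rule: finite_ne_induct)
    case (insert x A)
    then obtain m where m: "m \<in> A" "\<forall>m'\<in>A. m' \<noteq> m \<longrightarrow> monomial_less L m' m" by auto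
    have "x \<noteq> m" using insert.hyps(3) m(1) by blast
    then consider "monomial_less L x m" | "monomial_less L m x"
      using monomial_less_total[of x L m] insert.prems m(1) by auto
    then show ?case
    proof cases
      case 1
      then show ?thesis using m by (intro bexI[of _ m]) auto
    next
      case 2
      then have "monomial_less L m' x" if "m' \<in> A" for m'
        using m(2) that lex_less_trans by (cases "m' = m") blast+
      then show ?thesis by (intro bexI[of _ x]) auto
    qed
  qed simp
  from this[of "Poly_Mapping.keys f"] show ?thesis
    using assms by (auto simp: leading_def poly_ring_over_def)
qed

text \<open>
  The effect of \<open>\<phi>\<^sub>*\<close> on monomials.
\<close>

definition relabel :: "('v \<Rightarrow> 'v) \<Rightarrow> ('v \<Rightarrow>\<^sub>0 nat) \<Rightarrow> ('v \<Rightarrow>\<^sub>0 nat)" where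
  "relabel \<phi> m = (\<Sum>i\<in>Poly_Mapping.keys m. Poly_Mapping.single (\<phi> i) (Poly_Mapping.lookup m i))"

lemma cvar_power: "cvar i ^ n = Poly_Mapping.single (Poly_Mapping.single i n) 1"
  by (induction n) (simp_all add: cvar_def mult_single flip: single_add)

lemma prod_single: "(\<Prod>i\<in>A. Poly_Mapping.single (g i) (1 :: complex)) = Poly_Mapping.single (\<Sum>i\<in>A. g i) 1"
  by (induction A rule: infinite_finite_induct) (simp_all add: mult_single)

lemma pushforward_monomials:
  "pushforward \<phi> f =
     (\<Sum>m\<in>Poly_Mapping.keys f. Poly_Mapping.single (relabel \<phi> m) (Poly_Mapping.lookup f m))"
  unfolding pushforward_def relabel_def cconst_def by (simp add: cvar_power prod_single mult_single)

lemma lookup_relabel: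
  assumes "inj_on \<phi> V" "Poly_Mapping.keys m \<subseteq> V" "i \<in> V"
  shows "Poly_Mapping.lookup (relabel \<phi> m) (\<phi> i) = Poly_Mapping.lookup m i"
proof -
  have "Poly_Mapping.lookup (relabel \<phi> m) (\<phi> i) =
      (\<Sum>j\<in>Poly_Mapping.keys m. if j = i then Poly_Mapping.lookup m j else 0)"
    unfolding relabel_def lookup_sum
  proof (rule sum.cong)
    fix j assume "j \<in> Poly_Mapping.keys m"
    then have "\<phi> j = \<phi> i \<longleftrightarrow> j = i" using assms by (meson inj_on_eq_iff subsetD)
    then show "Poly_Mapping.lookup (Poly_Mapping.single (\<phi> j) (Poly_Mapping.lookup m j)) (\<phi> i) =
        (if j = i then Poly_Mapping.lookup m j else 0)"
      by (simp add: lookup_single when_def)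
  qed simp
  also have "\<dots> = Poly_Mapping.lookup m i" by (simp add: in_keys_iff)
  finally show ?thesis .
qed

lemma lookup_relabel_outside:
  assumes "y \<notin> \<phi> ` V" "Poly_Mapping.keys m \<subseteq> V"
  shows "Poly_Mapping.lookup (relabel \<phi> m) y = 0"
  unfolding relabel_def lookup_sum using assms by (intro sum.neutral) (auto simp: lookup_single when_def)

text \<open>
  This is where embeddings have to preserve the order of the leaves: an arbitrary renaming of
  variables need not respect the lexicographic order.
\<close>

lemma monomial_less_relabel:
  assumes \<phi>: "subseq (map \<phi> K) L" "distinct L"
    and keys: "Poly_Mapping.keys k \<subseteq> set K" "Poly_Mapping.keys k' \<subseteq> set K"
    and less: "monomial_less K k k'"
  shows "monomial_less L (relabel \<phi> k) (relabel \<phi> k')"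
proof (rule lex_less_subseq[OF \<phi>])
  have inj: "inj_on \<phi> (set K)" using subseq_distinct[OF \<phi>] by (simp add: distinct_map)
  show "Poly_Mapping.lookup (relabel \<phi> k) y = Poly_Mapping.lookup (relabel \<phi> k') y"
    if "y \<in> set L - set (map \<phi> K)" for y
    using that lookup_relabel_outside[of y \<phi> "set K"] keys by simp
  show "monomial_less (map \<phi> K) (relabel \<phi> k) (relabel \<phi> k')"
    unfolding lex_less_map using less
    by (subst lex_less_cong[of K _ "Poly_Mapping.lookup k" _ "Poly_Mapping.lookup k'"])
       (simp_all add: lookup_relabel[OF inj] keys)
qed

lemma lookup_sum_fun: "Poly_Mapping.lookup (a + b) = (\<lambda>x. Poly_Mapping.lookup a x + Poly_Mapping.lookup b x)"
  by (rule ext) (rule lookup_add)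

text \<open>
  One step of polynomial division: \<open>n\<close> and \<open>c\<close> are chosen such that the leading term of the multiple
  of \<open>pushforward \<phi> h\<close> cancels that of \<open>f\<close>.  All other monomials of this multiple are smaller, as \<open>\<phi>\<close>
  preserves the order of monomials and multiplication by \<open>n\<close> does so as well.
\<close>

lemma reduction_step:
  assumes f: "f \<in> carrier (poly_ring_over (set L))" "leading L f m"
    and h: "h \<in> carrier (poly_ring_over (set K))" "leading K h k"
    and \<phi>: "subseq (map \<phi> K) L" "distinct L"
    and divides: "\<forall>x\<in>set K. Poly_Mapping.lookup k x \<le> Poly_Mapping.lookup m (\<phi> x)"
  shows "\<exists>n c. Poly_Mapping.keys n \<subseteq> set L \<and>
    (\<forall>m'\<in>Poly_Mapping.keys (f + Poly_Mapping.single n c * pushforward \<phi> h). monomial_less L m' m)"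
proof -
  have inj: "inj_on \<phi> (set K)" using subseq_distinct[OF \<phi>] by (simp add: distinct_map)
  have h_keys: "Poly_Mapping.keys l \<subseteq> set K" if "l \<in> Poly_Mapping.keys h" for l
    using h(1) that by (simp add: poly_ring_over_def)
  have k: "k \<in> Poly_Mapping.keys h" using h(2) by (simp add: leading_def)
  define n where "n = m - relabel \<phi> k"
  have n: "n + relabel \<phi> k = m"
  proof (rule poly_mapping_eqI)
    fix y
    have "Poly_Mapping.lookup (relabel \<phi> k) y \<le> Poly_Mapping.lookup m y"
    proof (cases "y \<in> \<phi> ` set K")
      case True
      then show ?thesis using lookup_relabel[OF inj h_keys[OF k]] divides by auto
    next
      case False
      then show ?thesis using lookup_relabel_outside[OF _ h_keys[OF k]] by simp
    qed
    then show "Poly_Mapping.lookup (n + relabel \<phi> k) y = Poly_Mapping.lookup m y"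
      by (simp add: n_def lookup_add lookup_minus)
  qed
  have n_keys: "Poly_Mapping.keys n \<subseteq> Poly_Mapping.keys m"
    by (auto simp: n_def in_keys_iff lookup_minus)
  have m_keys: "Poly_Mapping.keys m \<subseteq> set L"
    using f by (auto simp: leading_def poly_ring_over_def)
  define c where "c = - Poly_Mapping.lookup f m / Poly_Mapping.lookup h k"
  define g where "g = Poly_Mapping.single n c * pushforward \<phi> h"
  have g: "g = (\<Sum>l\<in>Poly_Mapping.keys h. Poly_Mapping.single (n + relabel \<phi> l) (c * Poly_Mapping.lookup h l))"
    unfolding g_def pushforward_monomials sum_distrib_left by (simp add: mult_single)
  have less: "monomial_less L (n + relabel \<phi> l) m" if "l \<in> Poly_Mapping.keys h" "l \<noteq> k" for l
  proof -
    have "monomial_less K l k" using h(2) that by (simp add: leading_def)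
    then have "monomial_less L (relabel \<phi> l) (relabel \<phi> k)"
      using monomial_less_relabel[OF \<phi>] h_keys that(1) k by blast
    then have "lex_less L (\<lambda>x. Poly_Mapping.lookup n x + Poly_Mapping.lookup (relabel \<phi> l) x)
        (\<lambda>x. Poly_Mapping.lookup n x + Poly_Mapping.lookup (relabel \<phi> k) x)"
      by (simp only: lex_less_add)
    then have "monomial_less L (n + relabel \<phi> l) (n + relabel \<phi> k)"
      by (simp only: lookup_sum_fun)
    then show ?thesis using n by simp
  qed
  have "Poly_Mapping.lookup g m = (\<Sum>l\<in>Poly_Mapping.keys h. if l = k then c * Poly_Mapping.lookup h l else 0)"
    unfolding g lookup_sum
  proof (rule sum.cong)
    fix l assume l: "l \<in> Poly_Mapping.keys h"
    have "n + relabel \<phi> l = m \<longleftrightarrow> l = k"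
      using n less[OF l] lex_less_irrefl by metis
    then show "Poly_Mapping.lookup (Poly_Mapping.single (n + relabel \<phi> l) (c * Poly_Mapping.lookup h l)) m =
        (if l = k then c * Poly_Mapping.lookup h l else 0)"
      by (simp add: lookup_single when_def)
  qed simp
  also have "\<dots> = c * Poly_Mapping.lookup h k" using k by simp
  also have "\<dots> = - Poly_Mapping.lookup f m" using k by (simp add: c_def in_keys_iff)
  finally have cancel: "Poly_Mapping.lookup (f + g) m = 0" by (simp add: lookup_add)
  have "monomial_less L m' m" if m': "m' \<in> Poly_Mapping.keys (f + g)" for m'
  proof -
    have "m' \<noteq> m" using m' cancel by (auto simp: in_keys_iff)
    have "m' \<in> Poly_Mapping.keys f \<or> m' \<in> Poly_Mapping.keys g"
      using m' Poly_Mapping.keys_add[of f g] by blast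
    then show ?thesis
    proof
      assume "m' \<in> Poly_Mapping.keys f"
      then show ?thesis using f(2) \<open>m' \<noteq> m\<close> by (simp add: leading_def)
    next
      assume "m' \<in> Poly_Mapping.keys g"
      then have "m' \<in> (\<Union>l\<in>Poly_Mapping.keys h.
          Poly_Mapping.keys (Poly_Mapping.single (n + relabel \<phi> l) (c * Poly_Mapping.lookup h l)))"
        unfolding g by (rule subsetD[OF keys_sum])
      then obtain l where l: "l \<in> Poly_Mapping.keys h" "m' = n + relabel \<phi> l"
        by (auto simp: keys_single split: if_splits)
      then show ?thesis using less n \<open>m' \<noteq> m\<close> by blast
    qed
  qed
  moreover have "Poly_Mapping.keys n \<subseteq> set L" using n_keys m_keys by (rule subset_trans)
  ultimately show ?thesis unfolding g_def by (intro exI[of _ n] exI[of _ c] conjI ballI)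
qed

section \<open>Finite generation\<close>

text \<open>
  In terms of the codes, \<open>\<rho>\<close> is the failure of separation by a cluster, and the clusters of the source
  are the nonempty traces of those of the target.
\<close>

lemma tree_code_embedding:
  assumes s: "tree_code S s" and t: "tree_code T t" and \<phi>: "realizes P \<phi> s t"
  shows "boron_embedding \<phi> S T"
proof -
  have codes: "distinct (leaves t)" "set (leaves s) = hydrogen S" "set (leaves t) = hydrogen T"
    using s t by (simp_all add: tree_code_def)
  have image: "\<phi> ` hydrogen S \<subseteq> hydrogen T" using realizes_image[OF \<phi>] codes by simp
  have "distinct (map \<phi> (leaves s))"
    using \<phi> codes(1) by (auto simp: realizes_def dest: subseq_distinct)
  then have inj: "inj_on \<phi> (hydrogen S)" using codes(2) by (simp add: distinct_map)
  have "rho S w x y z \<longleftrightarrow> rho T (\<phi> w) (\<phi> x) (\<phi> y) (\<phi> z)"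
    if H: "w \<in> hydrogen S" "x \<in> hydrogen S" "y \<in> hydrogen S" "z \<in> hydrogen S" for w x y z
  proof -
    have "rho S w x y z \<longleftrightarrow> \<not> separated (clusters s) {w, x} {y, z}"
      using s H by (simp add: tree_code_def)
    also have "\<dots> \<longleftrightarrow> \<not> separated (clusters t) (\<phi> ` {w, x}) (\<phi> ` {y, z})"
      using separated_transfer[OF \<phi>, of "{w, x}" "{y, z}"] H codes(2) by simp
    also have "\<dots> \<longleftrightarrow> rho T (\<phi> w) (\<phi> x) (\<phi> y) (\<phi> z)"
      using t H image by (simp add: tree_code_def image_subset_iff)
    finally show ?thesis .
  qed
  then show ?thesis using image inj by (simp add: boron_embedding_def)
qed

theorem theorem1p2:
  fixes I :: "'v pair_pre_digraph \<Rightarrow> 'v cpoly set"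
  assumes "boric_chain I"
  shows "\<exists>(r::nat) (Ts :: nat \<Rightarrow> 'v pair_pre_digraph) (f :: nat \<Rightarrow> 'v cpoly).
    (\<forall>i \<in> {1..r}. boron_tree (Ts i) \<and> f i \<in> carrier (boron_ring (Ts i))) \<and>
    (\<forall>T. boron_tree T \<longrightarrow>
       I T = Idl\<^bsub>boron_ring T\<^esub>
         {pushforward \<phi> (f i) | i \<phi>. i \<in> {1..r} \<and> boron_embedding \<phi> (Ts i) T})"
proof -
  define shape where "shape t m = map_btree (Poly_Mapping.lookup m) t" for t :: "'v btree" and m :: "'v \<Rightarrow>\<^sub>0 nat"
  define W where "W T t f m \<longleftrightarrow> boron_tree T \<and> tree_code T t \<and> f \<in> I T \<and> leading (leaves t) f m"
    for T t f m
  have ideal: "ideal (I T) (boron_ring T)" if "boron_tree T" for T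
    using assms that by (simp add: boric_chain_def)
  have carrier: "f \<in> carrier (boron_ring T)" if "boron_tree T" "f \<in> I T" for T f
    using ideal.Icarr[OF ideal[OF that(1)] that(2)] .
  have push: "pushforward \<phi> f \<in> I T"
    if "boron_tree S" "boron_tree T" "boron_embedding \<phi> S T" "f \<in> I S" for S T \<phi> f
    using assms that unfolding boric_chain_def by blast
  define A where "A = {shape t m | T t f m. W T t f m}"
  have "\<exists>B. finite B \<and> B \<subseteq> A \<and> (\<forall>a\<in>A. \<exists>b\<in>B. embeds (\<le>) b a)"
    by (intro finite_basis kruskal_btree nat_sequence_not_decreasing)
  then obtain B where B: "finite B" "B \<subseteq> A" and basis: "\<And>a. a \<in> A \<Longrightarrow> \<exists>b\<in>B. embeds (\<le>) b a"
    by auto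
  have "\<forall>b\<in>B. \<exists>T t f m. b = shape t m \<and> W T t f m" using B(2) unfolding A_def by blast
  then obtain T' t' f' m' where W': "\<And>b. b \<in> B \<Longrightarrow> b = shape (t' b) (m' b) \<and> W (T' b) (t' b) (f' b) (m' b)"
    by metis
  \<comment> \<open>\<open>B\<close> is a set of labelled trees; its members are numbered to index the generators.\<close>
  obtain e where e: "bij_betw e {1..card B} B" using ex_bij_betw_nat_finite_1[OF B(1)] by blast
  define Ts where "Ts i = T' (e i)" for i
  define F where "F i = f' (e i)" for i
  have eB: "e i \<in> B" if "i \<in> {1..card B}" for i using e that by (auto simp: bij_betw_def)
  have F: "boron_tree (Ts i)" "F i \<in> I (Ts i)" if "i \<in> {1..card B}" for i
    using W'[OF eB[OF that]] by (simp_all add: W_def Ts_def F_def)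
  have generated: "I T = Idl\<^bsub>boron_ring T\<^esub>
      {pushforward \<phi> (F i) | i \<phi>. i \<in> {1..card B} \<and> boron_embedding \<phi> (Ts i) T}"
    (is "_ = Idl\<^bsub>_\<^esub> ?G") if T: "boron_tree T" for T
  proof
    interpret R: cring "boron_ring T" unfolding boron_ring_def by (rule cring_poly_ring_over)
    have G: "?G \<subseteq> I T" using push[OF _ T] F by blast
    show "Idl\<^bsub>boron_ring T\<^esub> ?G \<subseteq> I T" using ideal[OF T] G by (rule R.genideal_minimal)
    have G_carrier: "?G \<subseteq> carrier (boron_ring T)" using G carrier[OF T] by blast
    then have J: "ideal (Idl\<^bsub>boron_ring T\<^esub> ?G) (boron_ring T)" by (rule R.genideal_ideal)
    have G_J: "?G \<subseteq> Idl\<^bsub>boron_ring T\<^esub> ?G" using G_carrier by (rule R.genideal_self)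
    let ?J = "Idl\<^bsub>boron_ring T\<^esub> ?G"
    have add: "a + b \<in> K" if "ideal K (boron_ring T)" "a \<in> K" "b \<in> K" for a b K
      using additive_subgroup.a_closed[OF ideal.axioms(1)[OF that(1)] that(2,3)]
      by (simp add: boron_ring_def poly_ring_over_def)
    have mult: "a * b \<in> K" if "ideal K (boron_ring T)" "b \<in> K" "a \<in> carrier (boron_ring T)" for a b K
      using ideal.I_l_closed[OF that] by (simp add: boron_ring_def poly_ring_over_def)
    have zero: "0 \<in> ?J"
      using additive_subgroup.zero_closed[OF ideal.axioms(1)[OF J]]
      by (simp add: boron_ring_def poly_ring_over_def)
    obtain t where t: "tree_code T t" using boron_tree_has_code[OF T] by blast
    let ?L = "leaves t"
    have L: "distinct ?L" "set ?L = hydrogen T" using t by (simp_all add: tree_code_def)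
    have ring: "boron_ring T = poly_ring_over (set ?L)" using L by (simp add: boron_ring_def)
    \<comment> \<open>Division by the generators terminates as the leading monomial decreases.\<close>
    have "f \<in> I T \<longrightarrow> leading ?L f m \<longrightarrow> f \<in> ?J" for f m
    proof (induction m arbitrary: f rule: wf_induct_rule[OF wf_inv_image[OF wf_lex_less[of ?L], of Poly_Mapping.lookup]])
      case (1 m)
      show ?case
      proof (intro impI)
        assume f: "f \<in> I T" and m: "leading ?L f m"
        have "shape t m \<in> A" using T t f m unfolding A_def W_def by blast
        then obtain b where b: "b \<in> B" "embeds (\<le>) b (shape t m)" using basis by blast
        have "e ` {1..card B} = B" using e by (simp add: bij_betw_def)
        then have "b \<in> e ` {1..card B}" using b(1) by (simp only:)
        then obtain i where be: "b = e i" and i: "i \<in> {1..card B}" by (rule imageE)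
        define s where "s = t' b"
        define k where "k = m' b"
        have b_shape: "b = shape s k" and s: "tree_code (Ts i) s" and k: "leading (leaves s) (F i) k"
          using W'[OF b(1)] be by (simp_all add: W_def Ts_def F_def s_def k_def)
        have embeds: "embeds (\<lambda>x y. Poly_Mapping.lookup k x \<le> Poly_Mapping.lookup m y) s t"
          using b(2) unfolding b_shape shape_def embeds_map .
        have "distinct (leaves s)" using s by (simp add: tree_code_def)
        from embeds_realized[OF embeds this L(1)]
        obtain \<phi> where \<phi>: "realizes (\<lambda>x y. Poly_Mapping.lookup k x \<le> Poly_Mapping.lookup m y) \<phi> s t"
          by (rule exE)
        have emb: "boron_embedding \<phi> (Ts i) T" using s t \<phi> by (rule tree_code_embedding)
        let ?g = "pushforward \<phi> (F i)"
        have g: "?g \<in> I T" using F(1)[OF i] T emb F(2)[OF i] by (rule push)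
        have "?g \<in> ?G" using i emb by blast
        then have g_J: "?g \<in> ?J" by (rule subsetD[OF G_J])
        have "F i \<in> carrier (boron_ring (Ts i))" using carrier F[OF i] by blast
        then have Fi: "F i \<in> carrier (poly_ring_over (set (leaves s)))"
          using s by (simp add: boron_ring_def tree_code_def)
        have f_carrier: "f \<in> carrier (poly_ring_over (set ?L))" using carrier[OF T f] ring by simp
        have "subseq (map \<phi> (leaves s)) ?L"
          "\<forall>x\<in>set (leaves s). Poly_Mapping.lookup k x \<le> Poly_Mapping.lookup m (\<phi> x)"
          using \<phi> by (simp_all add: realizes_def)
        from reduction_step[OF f_carrier m Fi k this(1) L(1) this(2)]
        obtain n c where n: "Poly_Mapping.keys n \<subseteq> set ?L"
          and less: "\<And>m'. m' \<in> Poly_Mapping.keys (f + Poly_Mapping.single n c * ?g) \<Longrightarrow> monomial_less ?L m' m"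
          by auto
        have coefficient: "Poly_Mapping.single n d \<in> carrier (boron_ring T)" for d :: complex
          using n unfolding ring by (simp add: poly_ring_over_def)
        \<comment> \<open>The remainder is in \<open>I T\<close> because the generator is, and in \<open>?J\<close> by induction.\<close>
        let ?r = "f + Poly_Mapping.single n c * ?g"
        have r: "?r \<in> I T" by (intro add[OF ideal[OF T]] f mult[OF ideal[OF T]] g coefficient)
        have "?r \<in> ?J"
        proof (cases "?r = 0")
          case False
          then obtain m' where m': "leading ?L ?r m'"
            using leading_exists carrier[OF T r] ring by metis
          then have "monomial_less ?L m' m" by (intro less) (simp add: leading_def)
          then show ?thesis using "1.IH"[of m' ?r] r m' by simp
        qed (use zero in simp)
        moreover have "Poly_Mapping.single n (- c) * ?g \<in> ?J" by (intro mult[OF J] g_J coefficient)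
        ultimately have "?r + Poly_Mapping.single n (- c) * ?g \<in> ?J" by (rule add[OF J])
        moreover have "?r + Poly_Mapping.single n (- c) * ?g = f"
          by (simp add: single_uminus)
        ultimately show "f \<in> ?J" by simp
      qed
    qed
    note reduce = this
    show "I T \<subseteq> ?J"
    proof
      fix f assume f: "f \<in> I T"
      show "f \<in> ?J"
      proof (cases "f = 0")
        case False
        have "f \<in> carrier (poly_ring_over (set ?L))" using carrier[OF T f] ring by simp
        from leading_exists[OF False this] obtain m where "leading ?L f m" by (rule exE)
        then show ?thesis using reduce f by simp
      qed (use zero in simp)
    qed
  qed
  show ?thesis
  proof (intro exI conjI ballI allI impI)
    fix i assume i: "i \<in> {1..card B}"
    show "boron_tree (Ts i)" using i by (rule F(1))
    show "F i \<in> carrier (boron_ring (Ts i))" using F[OF i] by (rule carrier)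
  qed (rule generated)
qed

end
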